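(* Let $K$ be an origin-symmetric star body in $\mathbb{R}^n$. The space $(\mathbb{R}^n,\|\cdot\|_K)$ embeds in $L_0$ if and only if $\|x\|_K$ is the limit, in the radial metric, of finite products $\|x\|_{E_1}^{1/p_1}\cdots\|x\|_{E_m}^{1/p_m}$, where $E_1,\dots,E_m$ are ellipsoids and $p_1,\dots,p_m>0$ satisfy $1/p_1+\cdots+1/p_m=1$ (the number $m$, the ellipsoids and the exponents may vary along the approximating sequence).
   Context: An origin-symmetric star body in $\mathbb{R}^n$ is a compact set $K$, symmetric about the origin, such that every straight line through the origin crosses the boundary of $K$ at exactly two points, the boundary is continuous (i.e. the radial function $\rho_K(x)=\|x\|_K^{-1}$ is continuous on $S^{n-1}$), and the origin is an interior point of $K$. Its Minkowski functional is $\|x\|_K=\min\{a\ge 0: x\in aK\}$. The space $(\mathbb{R}^n,\|\cdot\|_K)$ embeds in $L_0$ if there exist a finite Borel (non-negative) measure $\mu$ on $S^{n-1}$ and a constant $C\in\mathbb{R}$ such that for every $x\in\mathbb{R}^n$, $\ln\|x\|_K=\int_{S^{n-1}}\ln|(x,\xi)|\,d\mu(\xi)+C$. The radial metric on origin-symmetric star bodies is $\rho(K,L)=\max_{x\in S^{n-1}}|\rho_K(x)-\rho_L(x)|$. A product $\|x\|_{E_1}^{1/p_1}\cdots\|x\|_{E_m}^{1/p_m}$, where $E_1,\dots,E_m$ are ellipsoids and $p_1,\dots,p_m>0$ satisfy $1/p_1+\cdots+1/p_m=1$, is the Minkowski functional of an origin-symmetric star body, and convergence in the radial metric refers to these bodies.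 Ellipsoids are centered at the origin and non-degenerate (images of the Euclidean unit ball under invertible linear maps). *)

theory Defs
  imports "HOL-Analysis.Analysis"
begin

text \<open>The infimum is a minimum when \<open>K\<close> is compact with \<open>0\<close> in its interior.\<close>

definition minkowski :: "(real ^ 'n) set \<Rightarrow> real ^ 'n \<Rightarrow> real" where
  "minkowski K x = Inf {a. 0 \<le> a \<and> x \<in> (\<lambda>y. a *\<^sub>R y) ` K}"

definition radial :: "(real ^ 'n) set \<Rightarrow> real ^ 'n \<Rightarrow> real" where
  "radial K x = inverse (minkowski K x)"

definition star_body :: "(real ^ 'n) set \<Rightarrow> bool" where
  "star_body K \<longleftrightarrow>
     compact K \<and>
     (\<forall>x\<in>K. - x \<in> K) \<and>
     (\<forall>u. u \<noteq> 0 \<longrightarrow> card (frontier K \<inter> range (\<lambda>t::real. t *\<^sub>R u)) = 2) \<and>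
     continuous_on (sphere 0 1) (radial K) \<and>
     0 \<in> interior K"

text \<open>The supremum is a maximum when \<open>radial K\<close> and \<open>radial L\<close> are continuous on the sphere.\<close>

definition radial_dist :: "(real ^ 'n) set \<Rightarrow> (real ^ 'n) set \<Rightarrow> real" where
  "radial_dist K L = (SUP x\<in>sphere 0 1. \<bar>radial K x - radial L x\<bar>)"

text \<open>Logarithm of a nonnegative real with \<open>ln 0 = - \<infinity>\<close>. The library's \<^term>\<open>ln (0::real)\<close> is
  \<open>0\<close>, which would be wrong at \<open>x = 0\<close> and on the directions orthogonal to \<open>x\<close>.\<close>

definition ext_ln :: "real \<Rightarrow> ereal" where
  "ext_ln t = (if t = 0 then - \<infinity> else ereal (ln t))"

text \<open>Lebesgue integral with values in \<open>[-\<infinity>, \<infinity>]\<close>, meaningful if the positive or the negative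
  part of \<open>f\<close> has finite integral; \<^const>\<open>e2ennreal\<close> sends negative arguments to \<open>0\<close>.\<close>

definition ext_integral :: "'a measure \<Rightarrow> ('a \<Rightarrow> ereal) \<Rightarrow> ereal" where
  "ext_integral M f =
     enn2ereal (\<integral>\<^sup>+ x. e2ennreal (f x) \<partial>M) - enn2ereal (\<integral>\<^sup>+ x. e2ennreal (- f x) \<partial>M)"

text \<open>The positive part of \<open>ln \<bar>(x, \<xi>)\<bar>\<close> is bounded on the sphere and \<open>\<mu>\<close> is finite, so the
  integral below is always well defined in \<open>[-\<infinity>, \<infinity>)\<close>.\<close>

definition embeds_in_L0 :: "(real ^ 'n) set \<Rightarrow> bool" where
  "embeds_in_L0 K \<longleftrightarrow>
     (\<exists>(\<mu> :: (real ^ 'n) measure) (C :: real).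
        finite_measure \<mu> \<and>
        sets \<mu> = sets (restrict_space borel (sphere 0 1)) \<and>
        (\<forall>x. ext_ln (minkowski K x) =
             ext_integral \<mu> (\<lambda>\<xi>. ext_ln \<bar>x \<bullet> \<xi>\<bar>) + ereal C))"

definition ellipsoid :: "(real ^ 'n) set \<Rightarrow> bool" where
  "ellipsoid E \<longleftrightarrow> (\<exists>f :: real ^ 'n \<Rightarrow> real ^ 'n. linear f \<and> bij f \<and> E = f ` cball 0 1)"

definition ellipsoid_product :: "(real ^ 'n \<Rightarrow> real) \<Rightarrow> bool" where
  "ellipsoid_product g \<longleftrightarrow>
     (\<exists>(m :: nat) (E :: nat \<Rightarrow> (real ^ 'n) set) (p :: nat \<Rightarrow> real).
        (\<forall>i\<in>{1..m}. ellipsoid (E i) \<and> 0 < p i) \<and>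
        (\<Sum>i=1..m. 1 / p i) = 1 \<and>
        g = (\<lambda>x. \<Prod>i=1..m. minkowski (E i) x powr (1 / p i)))"

end

theory Submission
  imports Defs "HOL-Probability.Probability"
begin

text \<open>If \<open>ln \<parallel>x\<parallel>\<^sub>K = \<integral> ln \<bar>(x, \<xi>)\<bar> d\<mu>(\<xi>) + C\<close>, replace \<open>ln \<bar>t\<bar>\<close> by
  \<open>\<ell>\<^sub>r(t) = ln (sqrt (t\<^sup>2 + r\<^sup>2))\<close>. The smoothed potentials decrease to \<open>ln \<parallel>x\<parallel>\<^sub>K - C\<close>, uniformly on
  the sphere by Dini's theorem, and for fixed \<open>r\<close> they are uniform limits of finite sums
  \<open>\<Sum> w\<^sub>z \<ell>\<^sub>r((x, z))\<close>, each term of which is the logarithm of an ellipsoid norm on the sphere.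

  Conversely, let \<open>N\<^sub>0\<close>, \<open>N\<close> be independent standard Gaussians in \<open>\<real>\<close> and \<open>\<real>\<^sup>n\<close>. Since
  \<open>(N\<^sub>0 x + r N, \<xi>)\<close> is Gaussian with variance \<open>(x, \<xi>)\<^sup>2 + r\<^sup>2\<close> for a unit vector \<open>\<xi>\<close>, every product
  \<open>g\<close> of ellipsoid norms satisfies \<open>E ln g(N\<^sub>0 x + r N) = \<integral> \<ell>\<^sub>r((x, \<xi>)) d\<mu>(\<xi>) + \<kappa>\<close> for a probability
  measure \<open>\<mu>\<close> on the sphere. Unlike the formula for \<open>r = 0\<close>, this one has a continuous integrand
  and passes to weak limits of \<open>\<mu>\<close>; then \<open>r \<rightarrow> 0\<close> by monotone convergence.\<close>

section \<open>The smoothed logarithm\<close>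

text \<open>The obstacle is the pole of the logarithm. When \<open>\<mu>\<^sub>k\<close> converges
  weakly to \<open>\<nu>\<close>, mass of \<open>\<mu>\<^sub>k\<close> may pile up near the
  hyperplane orthogonal to \<open>x\<close>, so at a fixed \<open>x\<close> the integrals of
  \<open>ln |(x, \<xi>)|\<close> need not converge to the one against \<open>\<nu>\<close>.
  Averaging the norms before passing to the limit removes the pole from the kernel, and uniform
  convergence of \<open>ln g\<close> off the origin survives any averaging against a probability
  measure. The factor \<open>N\<^sub>0\<close> makes the average computable: the pairing with
  \<open>\<xi>\<close> becomes centered, hence a multiple of one standard normal variable
  \<open>Z\<close>, whereas \<open>x + r N\<close> would give a shifted normal. For even homogeneous
  \<open>g\<close> the price is only the constant \<open>E ln |Z|\<close> in the limit
  \<open>r \<rightarrow> 0\<close>. The constants \<open>\<kappa>\<close> need no estimate: at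
  \<open>x = 0\<close>, \<open>r = 1\<close> the kernel vanishes, so \<open>\<kappa>\<close> equals
  the left-hand side there and converges with it. That the measures have mass one reflects
  homogeneity of degree one; it is what makes compactness available.\<close>

text \<open>The two integrands differ only where \<open>h\<close> vanishes: \<open>ext_ln 0\<close>
  is infinite, \<open>ln 0\<close> is \<open>0\<close>. A finite extended integral forces this set
  to be null, and then both integrals agree.\<close>

lemma ext_integral_ext_ln:
  assumes h [measurable]: "h \<in> borel_measurable M"
  shows "ext_integral M (\<lambda>\<xi>. ext_ln (h \<xi>)) = ereal c \<longleftrightarrow>
    (AE \<xi> in M. h \<xi> \<noteq> 0) \<and> integrable M (\<lambda>\<xi>. ln (h \<xi>)) \<and> (\<integral>\<xi>. ln (h \<xi>) \<partial>M) = c"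
    (is "?lhs \<longleftrightarrow> ?AE \<and> ?int \<and> ?eq")
proof -
  define P where "P = (\<integral>\<^sup>+ \<xi>. ennreal (ln (h \<xi>)) \<partial>M)"
  define N where "N = (\<integral>\<^sup>+ \<xi>. e2ennreal (- ext_ln (h \<xi>)) \<partial>M)"
  define N' where "N' = (\<integral>\<^sup>+ \<xi>. ennreal (- ln (h \<xi>)) \<partial>M)"
  have e1: "e2ennreal (ext_ln t) = ennreal (ln t)" for t
    by (simp add: ext_ln_def ennreal.abs_eq e2ennreal_neg)
  have e2: "e2ennreal (- ext_ln t) = (if t = 0 then \<infinity> else ennreal (- ln t))" for t
    by (simp add: ext_ln_def e2ennreal_infty)
  have lhs: "ext_integral M (\<lambda>\<xi>. ext_ln (h \<xi>)) = enn2ereal P - enn2ereal N"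
    by (simp add: ext_integral_def P_def N_def e1)
  have NN': "N = N'" if ?AE
    unfolding N_def N'_def e2 by (rule nn_integral_cong_AE) (use that in \<open>auto elim!: eventually_mono\<close>)
  have int: "?int \<longleftrightarrow> P \<noteq> \<infinity> \<and> N' \<noteq> \<infinity>"
    unfolding real_integrable_def P_def N'_def by simp
  have fin: "enn2ereal P - enn2ereal N' = ereal (\<integral>\<xi>. ln (h \<xi>) \<partial>M)" if ?int
  proof -
    have "P \<noteq> \<infinity>" "N' \<noteq> \<infinity>" using that int by auto
    then obtain p n where "P = ennreal p" "p \<ge> 0" "N' = ennreal n" "n \<ge> 0"
      by (metis ennreal_cases infinity_ennreal_def)
    with real_lebesgue_integral_def[OF that] show ?thesis
      by (simp add: P_def[symmetric] N'_def[symmetric])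
  qed
  show ?thesis
  proof
    assume L: ?lhs
    have PN: "P \<noteq> \<infinity>" "N \<noteq> \<infinity>"
    proof -
      have L': "enn2ereal P - enn2ereal N = ereal c" using L lhs by simp
      \<comment> \<open>In \<open>ereal\<close>, \<open>\<infinity>\<close> minus anything is
        \<open>\<infinity>\<close>, even \<open>\<infinity> - \<infinity>\<close>; a finite
        difference therefore excludes \<open>P = \<infinity>\<close> first and
        \<open>N = \<infinity>\<close> afterwards.\<close>
      have "enn2ereal P \<noteq> \<infinity>"
      proof
        assume "enn2ereal P = \<infinity>"
        then show False using L' by (cases "enn2ereal N") auto
      qed
      moreover from this have "enn2ereal N \<noteq> \<infinity>"
        using L' by (cases "enn2ereal P") auto
      ultimately show "P \<noteq> \<infinity>" "N \<noteq> \<infinity>" by auto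
    qed
    have "AE \<xi> in M. e2ennreal (- ext_ln (h \<xi>)) \<noteq> \<infinity>"
      by (rule nn_integral_PInf_AE) (use PN in \<open>auto simp: N_def e2\<close>)
    then have ae: ?AE by eventually_elim (auto simp: e2)
    with PN NN' int have i: ?int by simp
    from fin[OF i] L lhs NN'[OF ae] ae i show "?AE \<and> ?int \<and> ?eq" by simp
  next
    assume R: "?AE \<and> ?int \<and> ?eq"
    then show ?lhs using lhs NN' fin by simp
  qed
qed

lemma abs_ln_diff_le:
  fixes a b m :: real
  assumes "0 < m" "m \<le> a" "m \<le> b"
  shows "\<bar>ln a - ln b\<bar> \<le> \<bar>a - b\<bar> / m"
proof -
  have *: "ln y - ln x \<le> \<bar>x - y\<bar> / m" if "m \<le> x" "m \<le> y" for x y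
  proof -
    have "ln y - ln x = ln (y / x)" using that assms by (simp add: ln_div)
    also have "\<dots> \<le> y / x - 1" using that assms by (intro ln_le_minus_one) auto
    also have "\<dots> = (y - x) / x" using that assms by (simp add: field_simps)
    also have "\<dots> \<le> \<bar>x - y\<bar> / x" using that assms by (intro divide_right_mono) auto
    also have "\<dots> \<le> \<bar>x - y\<bar> / m" using that assms by (intro divide_left_mono) auto
    finally show ?thesis .
  qed
  from *[of a b] *[of b a] assms show ?thesis by (simp add: abs_minus_commute abs_le_iff)
qed

definition smooth_ln :: "real \<Rightarrow> real \<Rightarrow> real" where
  "smooth_ln r t = ln (sqrt (t\<^sup>2 + r\<^sup>2))"

lemma smooth_ln_lipschitz:
  assumes "0 < r"
  shows "\<bar>smooth_ln r s - smooth_ln r t\<bar> \<le> \<bar>s - t\<bar> / r"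
proof -
  have ge: "r \<le> sqrt (u\<^sup>2 + r\<^sup>2)" for u using assms by (intro real_le_rsqrt) auto
  \<comment> \<open>\<open>sqrt (t\<^sup>2 + r\<^sup>2)\<close> is the norm of the pair
    \<open>(t, r)\<close>, so the reverse triangle inequality makes it 1-Lipschitz in
    \<open>t\<close>.\<close>
  have "\<bar>sqrt (s\<^sup>2 + r\<^sup>2) - sqrt (t\<^sup>2 + r\<^sup>2)\<bar> \<le> \<bar>s - t\<bar>"
    using norm_triangle_ineq3[of "(s, r)" "(t, r)"] by (simp add: norm_Pair)
  then show ?thesis unfolding smooth_ln_def
    using abs_ln_diff_le[OF assms ge ge, of s t] assms
    by (meson divide_right_mono less_imp_le order_trans)
qed

lemma continuous_on_smooth_ln [continuous_intros]:
  fixes f :: "'a::t2_space \<Rightarrow> real"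
  assumes "continuous_on A f" "0 < r"
  shows "continuous_on A (\<lambda>x. smooth_ln r (f x))"
proof -
  have "t\<^sup>2 + r\<^sup>2 \<noteq> 0" for t using assms(2) by (simp add: sum_power2_eq_zero_iff)
  then show ?thesis
    unfolding smooth_ln_def using assms(1) by (intro continuous_intros) auto
qed

lemma smooth_ln_borel [measurable]: "smooth_ln r \<in> borel_measurable borel"
  unfolding smooth_ln_def by measurable

lemma smooth_ln_mono:
  assumes "0 < r" "r \<le> r'"
  shows "smooth_ln r t \<le> smooth_ln r' t"
proof -
  have "r\<^sup>2 \<le> r'\<^sup>2" "0 < r\<^sup>2" using assms by (auto intro: power_mono)
  then show ?thesis unfolding smooth_ln_def by (intro ln_mono) (auto simp: add_nonneg_pos)
qed

lemma ln_le_smooth_ln: "t \<noteq> 0 \<Longrightarrow> ln \<bar>t\<bar> \<le> smooth_ln r t"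
  unfolding smooth_ln_def by (intro ln_mono) (auto simp: sum_power2_gt_zero_iff intro: real_le_rsqrt)

lemma smooth_ln_tendsto:
  assumes "t \<noteq> 0" "r \<longlonglongrightarrow> 0"
  shows "(\<lambda>j. smooth_ln (r j) t) \<longlonglongrightarrow> ln \<bar>t\<bar>"
proof -
  have "(\<lambda>j. ln (sqrt (t\<^sup>2 + (r j)\<^sup>2))) \<longlonglongrightarrow> ln (sqrt (t\<^sup>2 + 0\<^sup>2))"
    by (intro tendsto_intros assms) (use assms in auto)
  then show ?thesis by (simp add: smooth_ln_def)
qed

section \<open>Star bodies, ellipsoids and homogeneous functions\<close>

text \<open>Common ground of Minkowski functionals, ellipsoid norms and their weighted products.
  Continuity is asked for on the sphere, where \<open>star_body\<close> provides it through
  \<open>radial\<close>; evenness is kept as a separate hypothesis.\<close>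

definition pos_homogeneous :: "('a::euclidean_space \<Rightarrow> real) \<Rightarrow> bool" where
  "pos_homogeneous g \<longleftrightarrow> (\<forall>a\<ge>0. \<forall>x. g (a *\<^sub>R x) = a * g x) \<and> (\<forall>x. x \<noteq> 0 \<longrightarrow> 0 < g x) \<and>
     continuous_on (sphere 0 1) g"

context
  fixes g :: "'a::euclidean_space \<Rightarrow> real"
  assumes g: "pos_homogeneous g"
begin

lemma pos_homogeneous_scale: "0 \<le> a \<Longrightarrow> g (a *\<^sub>R x) = a * g x"
  and pos_homogeneous_pos: "x \<noteq> 0 \<Longrightarrow> 0 < g x"
  and pos_homogeneous_continuous: "continuous_on (sphere 0 1) g"
  using g by (auto simp: pos_homogeneous_def)

lemma pos_homogeneous_0 [simp]: "g 0 = 0"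
  using pos_homogeneous_scale[of 0 0] by simp

lemma pos_homogeneous_sgn: "g x = norm x * g (sgn x)"
  using pos_homogeneous_scale[of "norm x" "sgn x"] by (cases "x = 0") (auto simp: sgn_div_norm)

lemma pos_homogeneous_ln: "x \<noteq> 0 \<Longrightarrow> ln (g x) = ln (norm x) + ln (g (sgn x))"
  using pos_homogeneous_pos[of "sgn x"] by (subst pos_homogeneous_sgn) (simp add: ln_mult sgn_zero_iff)

lemma pos_homogeneous_bounds:
  obtains m M where "0 < m" "\<And>x. norm x = 1 \<Longrightarrow> m \<le> g x \<and> g x \<le> M"
proof -
  have ne: "sphere (0::'a) 1 \<noteq> {}" by simp
  obtain a where a: "a \<in> sphere 0 1" "\<And>y. y \<in> sphere 0 1 \<Longrightarrow> g a \<le> g y"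
    using continuous_attains_inf[OF compact_sphere ne pos_homogeneous_continuous] by blast
  obtain b where b: "b \<in> sphere 0 1" "\<And>y. y \<in> sphere 0 1 \<Longrightarrow> g y \<le> g b"
    using continuous_attains_sup[OF compact_sphere ne pos_homogeneous_continuous] by blast
  show ?thesis
    by (rule that[of "g a" "g b"]) (use a b in \<open>auto intro!: pos_homogeneous_pos\<close>)
qed

lemma pos_homogeneous_isCont: "x \<noteq> 0 \<Longrightarrow> isCont g x"
proof -
  assume x: "x \<noteq> 0"
  have "continuous_on (- {0}) (\<lambda>x. norm x * g (sgn x))"
    by (intro continuous_intros continuous_on_compose2[OF pos_homogeneous_continuous])
      (auto simp: norm_sgn intro!: continuous_intros split: if_splits)
  then have "continuous_on (- {0}) g"
    using pos_homogeneous_sgn by (metis (no_types, lifting) continuous_on_cong)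
  then show ?thesis using x continuous_on_eq_continuous_at[of "- {0}" g] by (simp add: open_Compl)
qed

lemma pos_homogeneous_borel: "g \<in> borel_measurable borel"
proof -
  have "continuous_on (- {0}) g"
    by (intro continuous_at_imp_continuous_on ballI pos_homogeneous_isCont) auto
  then have "(\<lambda>x. indicator (- {0}) x *\<^sub>R g x) \<in> borel_measurable borel"
    by (rule borel_measurable_continuous_on_indicator[rotated]) auto
  moreover have "(\<lambda>x. indicator (- {0}) x *\<^sub>R g x) = g"
    by (auto simp: indicator_def fun_eq_iff)
  ultimately show ?thesis by simp
qed

text \<open>The difference depends only on the direction of \<open>x\<close>, hence is bounded by
  compactness of the sphere. This reduces integrability and domination for \<open>ln g\<close> to
  the Euclidean norm.\<close>

lemma pos_homogeneous_ln_bound: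
  obtains B where "0 \<le> B" "\<And>x. x \<noteq> 0 \<Longrightarrow> \<bar>ln (g x) - ln (norm x)\<bar> \<le> B"
proof -
  obtain m M where m: "0 < m" and mM: "\<And>x. norm x = 1 \<Longrightarrow> m \<le> g x \<and> g x \<le> M"
    using pos_homogeneous_bounds by blast
  have "\<bar>ln (g x) - ln (norm x)\<bar> \<le> \<bar>ln m\<bar> + \<bar>ln M\<bar>" if "x \<noteq> 0" for x
  proof -
    have "m \<le> g (sgn x)" "g (sgn x) \<le> M" using mM[of "sgn x"] that by (auto simp: norm_sgn)
    then have "ln m \<le> ln (g (sgn x))" "ln (g (sgn x)) \<le> ln M" using m by auto
    then show ?thesis using pos_homogeneous_ln[OF that] by linarith
  qed
  then show ?thesis using that[of "\<bar>ln m\<bar> + \<bar>ln M\<bar>"] by auto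
qed

end

section \<open>Minkowski functionals of star bodies\<close>

text \<open>A ball inside \<open>K\<close> makes the sets under the infimum nonempty, a ball around
  \<open>K\<close> keeps the infimum away from \<open>0\<close> for \<open>x \<noteq> 0\<close>, and
  continuity follows from that of \<open>radial\<close> by inversion.\<close>

lemma pos_homogeneous_minkowski:
  assumes "star_body K"
  shows "pos_homogeneous (minkowski K)"
proof -
  let ?A = "\<lambda>x. {a. 0 \<le> a \<and> x \<in> (\<lambda>y. a *\<^sub>R y) ` K}"
  have K: "compact K" "0 \<in> interior K" "continuous_on (sphere 0 1) (radial K)"
    using assms by (auto simp: star_body_def)
  obtain e where e: "e > 0" "cball 0 e \<subseteq> K" using K(2) mem_interior_cball by blast
  obtain R where R: "R > 0" "\<And>y. y \<in> K \<Longrightarrow> norm y \<le> R"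
    using compact_imp_bounded[OF K(1)] bounded_pos by metis
  have ne: "?A x \<noteq> {}" for x
  proof -
    have "(e / norm x) *\<^sub>R x \<in> K" if "x \<noteq> 0" using e that by auto
    moreover have "x = (norm x / e) *\<^sub>R ((e / norm x) *\<^sub>R x)" if "x \<noteq> 0" using e that by simp
    moreover have "0 = (0::real) *\<^sub>R (0 :: real ^ 'a)" "0 \<in> K" using e by auto
    ultimately have "\<exists>a\<ge>0. \<exists>y\<in>K. x = a *\<^sub>R y"
      using e(1) by (metis divide_nonneg_pos norm_ge_zero order_refl)
    then show ?thesis by blast
  qed
  have bdd: "bdd_below (?A x)" for x by (rule bdd_belowI[of _ 0]) auto
  have pos: "0 < minkowski K x" if "x \<noteq> 0" for x
  proof -
    have "norm x / R \<le> a" if "a \<in> ?A x" for a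
    proof -
      from that obtain y where "y \<in> K" "x = a *\<^sub>R y" "0 \<le> a" by auto
      then have "norm x \<le> a * R" using R(2)[of y] by (auto intro: mult_left_mono)
      then show ?thesis using R(1) by (simp add: field_simps)
    qed
    then have "norm x / R \<le> minkowski K x" unfolding minkowski_def by (intro cInf_greatest ne) auto
    moreover have "0 < norm x / R" using that R(1) by simp
    ultimately show ?thesis by linarith
  qed
  have zero: "minkowski K 0 = 0"
    unfolding minkowski_def
    by (rule cInf_eq_minimum) (use e in \<open>auto intro!: image_eqI[of _ _ 0]\<close>)
  have le: "minkowski K (a *\<^sub>R x) \<le> a * minkowski K x" if a: "0 < a" for a x
  proof -
    have "minkowski K (a *\<^sub>R x) / a \<le> b" if "b \<in> ?A x" for b
    proof -
      from that obtain y where "y \<in> K" "x = b *\<^sub>R y" "0 \<le> b" by auto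
      then have "a * b \<in> ?A (a *\<^sub>R x)" using a by auto
      then have "minkowski K (a *\<^sub>R x) \<le> a * b" unfolding minkowski_def by (rule cInf_lower[OF _ bdd])
      then show ?thesis using a by (simp add: field_simps)
    qed
    then have "minkowski K (a *\<^sub>R x) / a \<le> minkowski K x"
      unfolding minkowski_def[of K x] by (intro cInf_greatest ne) auto
    then show ?thesis using a by (simp add: field_simps)
  qed
  have hom: "minkowski K (a *\<^sub>R x) = a * minkowski K x" if "0 \<le> a" for a x
  proof (cases "a = 0")
    case False
    then have a: "0 < a" using that by simp
    have "minkowski K ((1 / a) *\<^sub>R (a *\<^sub>R x)) \<le> (1 / a) * minkowski K (a *\<^sub>R x)"
      using a by (intro le) simp
    then have "a * minkowski K x \<le> minkowski K (a *\<^sub>R x)" using a by (simp add: field_simps)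
    with le[OF a, of x] show ?thesis by simp
  qed (simp add: zero)
  have "radial K x \<noteq> 0" if "x \<in> sphere 0 1" for x
  proof -
    have "x \<noteq> 0" using that by auto
    from pos[OF this] show ?thesis by (simp add: radial_def)
  qed
  then have "continuous_on (sphere 0 1) (\<lambda>x. inverse (radial K x))"
    using K(3) by (intro continuous_on_inverse) blast+
  then have "continuous_on (sphere 0 1) (minkowski K)" by (simp add: radial_def)
  with pos hom show ?thesis by (auto simp: pos_homogeneous_def)
qed

lemma minkowski_minus:
  assumes "star_body K"
  shows "minkowski K (- x) = minkowski K x"
proof -
  have *: "- y \<in> K \<longleftrightarrow> y \<in> K" for y
    using assms unfolding star_body_def by (metis minus_minus)
  have "- x \<in> (\<lambda>y. a *\<^sub>R y) ` K \<longleftrightarrow> x \<in> (\<lambda>y. a *\<^sub>R y) ` K" for a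
  proof
    assume "- x \<in> (\<lambda>y. a *\<^sub>R y) ` K"
    then obtain y where "y \<in> K" "- x = a *\<^sub>R y" by auto
    then show "x \<in> (\<lambda>y. a *\<^sub>R y) ` K"
      using * by (intro image_eqI[of _ _ "- y"]) (auto simp: minus_equation_iff[of x])
  next
    assume "x \<in> (\<lambda>y. a *\<^sub>R y) ` K"
    then show "- x \<in> (\<lambda>y. a *\<^sub>R y) ` K"
      using * by (auto intro!: image_eqI[of "- (a *\<^sub>R y)" _ "- y" for y])
  qed
  then show ?thesis unfolding minkowski_def by simp
qed

text \<open>The admissible factors form exactly the half-line \<open>{g x..}\<close>. Thus
  approximants can be constructed as functions and turned into bodies afterwards.\<close>

lemma minkowski_sublevel:
  assumes "pos_homogeneous g"
  shows "minkowski {y. g y \<le> 1} = g"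
proof
  fix x
  note hom = pos_homogeneous_scale[OF assms] and pos = pos_homogeneous_pos[OF assms]
  have nn: "0 \<le> g x" using pos[of x] pos_homogeneous_0[OF assms] by (cases "x = 0") auto
  have "{a. 0 \<le> a \<and> x \<in> (\<lambda>y. a *\<^sub>R y) ` {y. g y \<le> 1}} = {g x..}"
  proof (intro equalityI subsetI)
    fix a assume "a \<in> {a. 0 \<le> a \<and> x \<in> (\<lambda>y. a *\<^sub>R y) ` {y. g y \<le> 1}}"
    then obtain y where "0 \<le> a" "x = a *\<^sub>R y" "g y \<le> 1" by auto
    then show "a \<in> {g x..}" using mult_left_mono[of "g y" 1 a] by (simp add: hom)
  next
    fix a assume "a \<in> {g x..}"
    then have a: "g x \<le> a" by simp
    show "a \<in> {a. 0 \<le> a \<and> x \<in> (\<lambda>y. a *\<^sub>R y) ` {y. g y \<le> 1}}"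
    proof (cases "a = 0")
      case True
      then have "x = 0" using a pos[of x] by force
      then show ?thesis using True pos_homogeneous_0[OF assms] by (auto intro!: image_eqI[of _ _ 0])
    next
      case False
      with a nn have "0 < a" by simp
      then have "g ((1 / a) *\<^sub>R x) \<le> 1" using a by (subst hom) auto
      then show ?thesis using \<open>0 < a\<close> by (auto intro!: image_eqI[of _ _ "(1 / a) *\<^sub>R x"])
    qed
  qed
  then show "minkowski {y. g y \<le> 1} x = g x" by (simp add: minkowski_def)
qed

text \<open>Along a ray \<open>g\<close> grows strictly, so the frontier is the level set
  \<open>g = 1\<close> and each ray meets it once; evenness places the two points of a line at
  opposite parameters.\<close>

lemma star_body_sublevel:
  fixes g :: "real ^ 'n \<Rightarrow> real"
  assumes g: "pos_homogeneous g" and cont: "continuous_on UNIV g" and even: "\<And>x. g (- x) = g x"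
  shows "star_body {y. g y \<le> 1}"
proof -
  note hom = pos_homogeneous_scale[OF g] and pos = pos_homogeneous_pos[OF g]
    and zero = pos_homogeneous_0[OF g]
  let ?K = "{y. g y \<le> 1}"
  have closed: "closed ?K" using cont by (intro closed_Collect_le) auto
  have op: "open {y. g y < 1}" using cont by (intro open_Collect_less) auto
  obtain m M where m: "0 < m" and mM: "\<And>x. norm x = 1 \<Longrightarrow> m \<le> g x \<and> g x \<le> M"
    using pos_homogeneous_bounds[OF g] by blast
  have "norm y \<le> 1 / m" if "g y \<le> 1" for y
  proof (cases "y = 0")
    case False
    then have "m * norm y \<le> g y"
      using mM[of "sgn y"] by (subst pos_homogeneous_sgn[OF g]) (simp add: norm_sgn mult.commute)
    then show ?thesis using that m by (simp add: field_simps)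
  qed (use m in simp)
  then have "compact ?K" using closed by (auto simp: compact_eq_bounded_closed intro!: boundedI)
  moreover have "0 \<in> interior ?K"
    by (rule interiorI[OF op]) (auto simp: zero)
  moreover have "interior ?K \<subseteq> {y. g y < 1}"
  proof
    fix y assume y: "y \<in> interior ?K"
    then obtain e where e: "e > 0" "ball y e \<subseteq> ?K" using mem_interior by blast
    show "y \<in> {y. g y < 1}"
    proof (cases "y = 0")
      case False
      \<comment> \<open>Stretching by this factor moves \<open>y\<close> by \<open>e / 2\<close>,
        which stays inside the ball and hence inside the sublevel set, although \<open>g\<close> has
        strictly increased.\<close>
      define a where "a = 1 + e / (2 * norm y)"
      have a: "a > 1" using e False by (simp add: a_def)
      have "y - a *\<^sub>R y = (- e / (2 * norm y)) *\<^sub>R y" by (simp add: a_def algebra_simps)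
      then have "dist y (a *\<^sub>R y) = e / 2" using False e by (simp add: dist_norm)
      then have "a *\<^sub>R y \<in> ?K" using e by (intro subsetD[OF e(2)]) auto
      then have "a * g y \<le> 1" using hom[of a y] a by simp
      moreover have "1 * g y < a * g y" using pos[OF False] a by (intro mult_strict_right_mono) auto
      ultimately show ?thesis by simp
    qed (simp add: zero)
  qed
  moreover have "{y. g y < 1} \<subseteq> interior ?K" by (rule interior_maximal[OF _ op]) auto
  ultimately have fr: "frontier ?K = {y. g y = 1}"
    using closed by (auto simp: frontier_def)
  have "card (frontier ?K \<inter> range (\<lambda>t::real. t *\<^sub>R u)) = 2" if u: "u \<noteq> 0" for u
  proof -
    have abs: "g (t *\<^sub>R u) = \<bar>t\<bar> * g u" for t
      using hom[of "\<bar>t\<bar>" u] even[of "t *\<^sub>R u"] by (cases "t \<ge> 0") auto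
    have eq: "\<bar>t\<bar> * g u = 1 \<longleftrightarrow> t = 1 / g u \<or> t = - (1 / g u)" for t
    proof -
      define c where "c = 1 / g u"
      have c: "0 < c" using pos[OF u] by (simp add: c_def)
      have "\<bar>t\<bar> * g u = 1 \<longleftrightarrow> \<bar>t\<bar> = c" using pos[OF u] by (simp add: c_def field_simps)
      also have "\<dots> \<longleftrightarrow> t = c \<or> t = - c" using c by auto
      finally show ?thesis by (simp only: c_def)
    qed
    have mem: "t *\<^sub>R u \<in> frontier ?K \<longleftrightarrow> t = 1 / g u \<or> t = - (1 / g u)" for t
      using abs[of t] eq[of t] unfolding fr by simp
    have "frontier ?K \<inter> range (\<lambda>t. t *\<^sub>R u) = (\<lambda>t. t *\<^sub>R u) ` {t. t *\<^sub>R u \<in> frontier ?K}"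
      by blast
    also have "{t. t *\<^sub>R u \<in> frontier ?K} = {1 / g u, - (1 / g u)}"
      unfolding mem by blast
    finally have "frontier ?K \<inter> range (\<lambda>t. t *\<^sub>R u) = {(1 / g u) *\<^sub>R u, (- (1 / g u)) *\<^sub>R u}"
      by (simp only: image_insert image_empty)
    moreover have "(1 / g u) *\<^sub>R u \<noteq> (- (1 / g u)) *\<^sub>R u"
      using u pos[OF u] by (simp add: scaleR_cancel_right del: scaleR_minus_left)
    ultimately show ?thesis by simp
  qed
  moreover have "continuous_on (sphere 0 1) (radial ?K)"
    unfolding radial_def minkowski_sublevel[OF g]
  proof (intro continuous_on_inverse[OF pos_homogeneous_continuous[OF g]] ballI)
    fix x :: "real ^ 'n" assume "x \<in> sphere 0 1"
    then have "x \<noteq> 0" by auto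
    from pos[OF this] show "g x \<noteq> 0" by simp
  qed
  ultimately show ?thesis
    using \<open>compact ?K\<close> \<open>0 \<in> interior ?K\<close> even by (auto simp: star_body_def)
qed

section \<open>Norms of ellipsoids and their weighted products\<close>

lemma pos_homogeneous_norm_linear:
  fixes T :: "real ^ 'n \<Rightarrow> real ^ 'n"
  assumes "linear T" "inj T"
  shows "pos_homogeneous (\<lambda>x. norm (T x))"
proof -
  have "T x \<noteq> 0" if "x \<noteq> 0" for x
    using assms that linear_injective_0 by blast
  moreover have "continuous_on (sphere 0 1) (\<lambda>x. norm (T x))"
    by (intro continuous_intros linear_continuous_on assms(1)[unfolded linear_conv_bounded_linear])
  ultimately show ?thesis
    using assms(1) by (auto simp: pos_homogeneous_def linear_cmul)
qed

lemma ellipsoidE: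
  assumes "ellipsoid (E :: (real ^ 'n) set)"
 obtains T :: "real ^ 'n \<Rightarrow> real ^ 'n" where "linear T" "bij T" "minkowski E = (\<lambda>x. norm (T x))"
proof -
  obtain f :: "real ^ 'n \<Rightarrow> real ^ 'n" where f: "linear f" "bij f" "E = f ` cball 0 1"
    using assms by (auto simp: ellipsoid_def)
  have T: "linear (inv f)" "bij (inv f)" using f bij_imp_bij_inv inj_linear_imp_inv_linear bij_is_inj by blast+
  have "E = {y. norm (inv f y) \<le> 1}"
    unfolding f(3) bij_image_Collect_eq[OF f(2)] cball_def by (simp add: dist_norm bij_image_Collect_eq[OF f(2)])
  then show ?thesis using minkowski_sublevel[OF pos_homogeneous_norm_linear[OF T(1) bij_is_inj[OF T(2)]]] T that[of "inv f"] by simp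
qed

lemma ellipsoid_norm_linear:
  fixes T :: "real ^ 'n \<Rightarrow> real ^ 'n"
  assumes T: "linear T" "bij T"
  obtains E where "ellipsoid E" "minkowski E = (\<lambda>x. norm (T x))"
proof -
  have i: "linear (inv T)" "bij (inv T)" using T bij_imp_bij_inv inj_linear_imp_inv_linear bij_is_inj by blast+
  have "{y. norm (T y) \<le> 1} = inv T ` cball 0 1"
    using bij_image_Collect_eq[OF i(2)] inv_inv_eq[OF T(2)] by (simp add: cball_def dist_norm)
  with i have "ellipsoid {y. norm (T y) \<le> 1}" by (auto simp: ellipsoid_def)
  then show ?thesis using that minkowski_sublevel[OF pos_homogeneous_norm_linear[OF T(1) bij_is_inj[OF T(2)]]] by blast
qed

lemma ellipsoid_productE:
  fixes g :: "real ^ 'n \<Rightarrow> real"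
  assumes "ellipsoid_product g"
  obtains m :: nat and T :: "nat \<Rightarrow> real ^ 'n \<Rightarrow> real ^ 'n" and w
  where "\<And>i. i \<in> {1..m} \<Longrightarrow> linear (T i) \<and> bij (T i) \<and> 0 < w i" "sum w {1..m} = 1"
    "\<And>x. x \<noteq> 0 \<Longrightarrow> ln (g x) = (\<Sum>i=1..m. w i * ln (norm (T i x)))"
proof -
  obtain m :: nat and E :: "nat \<Rightarrow> (real ^ 'n) set" and p where
    E: "\<And>i. i \<in> {1..m} \<Longrightarrow> ellipsoid (E i) \<and> 0 < p i" and s: "(\<Sum>i=1..m. 1 / p i) = 1"
    and g: "g = (\<lambda>x. \<Prod>i=1..m. minkowski (E i) x powr (1 / p i))"
    using assms unfolding ellipsoid_product_def by blast
  have "\<forall>i\<in>{1..m}. \<exists>T :: real ^ 'n \<Rightarrow> real ^ 'n. linear T \<and> bij T \<and> minkowski (E i) = (\<lambda>x. norm (T x))"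
  proof
    fix i assume "i \<in> {1..m}"
    then have "ellipsoid (E i)" using E by blast
    then show "\<exists>T :: real ^ 'n \<Rightarrow> real ^ 'n. linear T \<and> bij T \<and> minkowski (E i) = (\<lambda>x. norm (T x))" by (rule ellipsoidE) blast
  qed
  from bchoice[OF this] obtain T :: "nat \<Rightarrow> real ^ 'n \<Rightarrow> real ^ 'n" where
    T: "\<And>i. i \<in> {1..m} \<Longrightarrow> linear (T i) \<and> bij (T i) \<and> minkowski (E i) = (\<lambda>x. norm (T i x))"
    by blast
  have "ln (g x) = (\<Sum>i=1..m. 1 / p i * ln (norm (T i x)))" if "x \<noteq> 0" for x
  proof -
    have "0 < norm (T i x)" if "i \<in> {1..m}" for i
      using T[OF that] \<open>x \<noteq> 0\<close> by (intro pos_homogeneous_pos[OF pos_homogeneous_norm_linear, of "T i"]) (auto intro: bij_is_inj)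
    then have "ln (\<Prod>i=1..m. norm (T i x) powr (1 / p i)) = (\<Sum>i=1..m. ln (norm (T i x) powr (1 / p i)))"
      by (intro ln_prod) (auto simp: less_le)
    moreover have "g x = (\<Prod>i=1..m. norm (T i x) powr (1 / p i))"
      unfolding g using T by (intro prod.cong) auto
    ultimately show ?thesis by (simp add: ln_powr)
  qed
  then show ?thesis using that[of m T "\<lambda>i. 1 / p i"] T E s by simp
qed

text \<open>An arbitrary finite index set is allowed because the factors will be indexed by the
  atoms of a discrete measure; a bijection with \<open>{1..card I}\<close> restores the form of the
  definition. Weights of sum one give degree one.\<close>

lemma ellipsoid_productI:
  fixes T :: "'i \<Rightarrow> real ^ 'n \<Rightarrow> real ^ 'n"
  assumes I: "finite I" and T: "\<And>i. i \<in> I \<Longrightarrow> linear (T i) \<and> bij (T i) \<and> 0 < w i" and w: "sum w I = 1"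
  defines "g \<equiv> \<lambda>x. \<Prod>i\<in>I. norm (T i x) powr w i"
  shows "ellipsoid_product g" "pos_homogeneous g" "continuous_on UNIV g" "g (- x) = g x"
    "x \<noteq> 0 \<Longrightarrow> ln (g x) = (\<Sum>i\<in>I. w i * ln (norm (T i x)))"
proof -
  have Tpos: "0 < norm (T i x)" if "i \<in> I" "x \<noteq> 0" for i x
    using pos_homogeneous_pos[OF pos_homogeneous_norm_linear that(2)] T[OF that(1)] bij_is_inj by blast
  have "\<forall>i\<in>I. \<exists>E. ellipsoid E \<and> minkowski E = (\<lambda>x. norm (T i x))"
  proof
    fix i assume "i \<in> I"
    then have "linear (T i)" "bij (T i)" using T by blast+
    then show "\<exists>E. ellipsoid E \<and> minkowski E = (\<lambda>x. norm (T i x))" by (rule ellipsoid_norm_linear) blast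
  qed
  from bchoice[OF this] obtain E where
    E: "\<And>i. i \<in> I \<Longrightarrow> ellipsoid (E i) \<and> minkowski (E i) = (\<lambda>x. norm (T i x))"
    by blast
  obtain h where h: "bij_betw h {1..card I} I" using ex_bij_betw_nat_finite_1[OF I] by blast
  show "ellipsoid_product g" unfolding ellipsoid_product_def
  proof (intro exI[of _ "card I"] exI[of _ "E \<circ> h"] exI[of _ "\<lambda>i. 1 / w (h i)"] conjI ballI)
    fix i assume "i \<in> {1..card I}"
    then have "h i \<in> I" using h bij_betwE by blast
    then show "ellipsoid ((E \<circ> h) i)" "0 < 1 / w (h i)" using E T by auto
  next
    show "(\<Sum>i=1..card I. 1 / (1 / w (h i))) = 1"
      using sum.reindex_bij_betw[OF h, of w] w by simp
  next
    show "g = (\<lambda>x. \<Prod>i = 1..card I. minkowski ((E \<circ> h) i) x powr (1 / (1 / w (h i))))"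
    proof
      fix x
      have "(\<Prod>i\<in>I. norm (T i x) powr w i) = (\<Prod>i\<in>I. minkowski (E i) x powr w i)"
        using E by (intro prod.cong) auto
      then show "g x = (\<Prod>i = 1..card I. minkowski ((E \<circ> h) i) x powr (1 / (1 / w (h i))))"
        unfolding g_def using prod.reindex_bij_betw[OF h, of "\<lambda>i. minkowski (E i) x powr w i"] by simp
    qed
  qed
  show c: "continuous_on UNIV g" unfolding g_def
  proof (intro continuous_on_prod)
    fix i assume i: "i \<in> I"
    then have "continuous_on UNIV (\<lambda>x. norm (T i x))"
      using T[OF i] by (intro continuous_intros linear_continuous_on) (simp add: linear_conv_bounded_linear)
    then show "continuous_on UNIV (\<lambda>x. norm (T i x) powr w i)"
      by (intro continuous_on_powr') (use T[OF i] in auto)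
  qed
  show "pos_homogeneous g" unfolding pos_homogeneous_def
  proof (intro conjI allI impI)
    fix a :: real and x assume a: "0 \<le> a"
    have "g (a *\<^sub>R x) = (\<Prod>i\<in>I. a powr w i * norm (T i x) powr w i)"
      unfolding g_def using T a by (intro prod.cong refl) (simp add: linear_cmul powr_mult)
    also have "\<dots> = (\<Prod>i\<in>I. a powr w i) * g x" by (simp add: prod.distrib g_def)
    also have "(\<Prod>i\<in>I. a powr w i) = a"
    proof (cases "a = 0")
      case True
      \<comment> \<open>An empty product would be \<open>1\<close> instead of \<open>0\<close>;
        weights of sum one rule it out.\<close>
      have "I \<noteq> {}" using w by auto
      then show ?thesis using True I by (simp add: card_gt_0_iff)
    next
      case False
      then show ?thesis using a powr_sum[of a w I] I w by simp
    qed
    finally show "g (a *\<^sub>R x) = a * g x" .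
  next
    fix x :: "real ^ 'n" assume "x \<noteq> 0"
    then show "0 < g x" unfolding g_def using Tpos by (intro prod_pos) (auto simp: less_le)
  next
    show "continuous_on (sphere 0 1) g" using c continuous_on_subset by blast
  qed
  show "g (- x) = g x" unfolding g_def using T by (intro prod.cong) (auto simp: linear_neg)
  show "ln (g x) = (\<Sum>i\<in>I. w i * ln (norm (T i x)))" if "x \<noteq> 0"
  proof -
    have "ln (g x) = (\<Sum>i\<in>I. ln (norm (T i x) powr w i))"
      unfolding g_def by (intro ln_prod I) (use Tpos that in \<open>auto simp: less_le\<close>)
    then show ?thesis using Tpos[OF _ that] by (simp add: ln_powr)
  qed
qed

section \<open>Weak compactness of probability measures on a compact set\<close>

definition binary_digit :: "real \<Rightarrow> nat \<Rightarrow> int" where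
  "binary_digit u k = \<lfloor>2 ^ Suc k * u\<rfloor> - 2 * \<lfloor>2 ^ k * u\<rfloor>"

lemma binary_digit_cases: "binary_digit u k \<in> {0, 1}"
proof -
  have "2 ^ Suc k * u = 2 * (2 ^ k * u)" by simp
  moreover have "\<lfloor>2 * x\<rfloor> - 2 * \<lfloor>x\<rfloor> \<in> {0, 1}" for x :: real by (simp; linarith)
  ultimately show ?thesis unfolding binary_digit_def by presburger
qed

text \<open>The partial sums telescope to the truncations
  \<open>\<lfloor>2 ^ m * u\<rfloor> / 2 ^ m\<close>; the range of \<open>u\<close> enters as
  \<open>\<lfloor>u\<rfloor> = 0\<close> at the start.\<close>

lemma binary_digit_sums:
  assumes "0 \<le> u" "u < 1"
  shows "(\<lambda>k. of_int (binary_digit u k) / 2 ^ Suc k) sums u"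
proof -
  have part: "(\<Sum>k<m. of_int (binary_digit u k) / 2 ^ Suc k) = of_int \<lfloor>2 ^ m * u\<rfloor> / (2 ^ m :: real)" for m
  proof (induction m)
    case 0
    have "\<lfloor>u\<rfloor> = 0" using assms by (simp add: floor_eq_iff)
    then show ?case by simp
  next
    case (Suc m)
    then show ?case by (simp add: binary_digit_def field_simps)
  qed
  have lim: "(\<lambda>m. (1 / 2) ^ m) \<longlonglongrightarrow> (0::real)" by (rule LIMSEQ_power_zero) simp
  have le: "norm (of_int \<lfloor>2 ^ m * u\<rfloor> / (2 ^ m :: real) - u) \<le> (1 / 2) ^ m" for m
  proof -
    have "\<bar>of_int \<lfloor>2 ^ m * u\<rfloor> - 2 ^ m * u\<bar> \<le> 1" by linarith
    moreover have "of_int \<lfloor>2 ^ m * u\<rfloor> / (2 ^ m :: real) - u = (of_int \<lfloor>2 ^ m * u\<rfloor> - 2 ^ m * u) / 2 ^ m"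
      by (simp add: field_simps)
    ultimately show ?thesis by (simp add: power_divide divide_right_mono)
  qed
  have "(\<lambda>m. of_int \<lfloor>2 ^ m * u\<rfloor> / (2 ^ m :: real) - u) \<longlonglongrightarrow> 0"
    by (rule Lim_null_comparison[OF always_eventually[OF allI[OF le]] lim])
  then show ?thesis unfolding sums_def part by (rule LIM_zero_cancel)
qed

text \<open>Modulo \<open>2\<close>, this continuous function is \<open>0\<close> on \<open>[0, 1/3]\<close> and \<open>1\<close> on \<open>[2/3, 1]\<close>.\<close>

definition digit_wave :: "real \<Rightarrow> real" where
  "digit_wave t = max 0 (min 1 (1 / 2 - cos (pi * t)))"

lemma digit_wave_bounds: "0 \<le> digit_wave t" "digit_wave t \<le> 1"
  by (auto simp: digit_wave_def)

lemma continuous_on_digit_wave [continuous_intros]: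
  fixes A :: "real set"
  shows "continuous_on A f \<Longrightarrow> continuous_on A (\<lambda>t. digit_wave (f t))"
  unfolding digit_wave_def by (intro continuous_intros)

text \<open>For bits \<open>b\<close> this is a point of the Cantor set. With digits
  \<open>0\<close> and \<open>2\<close> only, every shifted tail lies in \<open>[0, 1/3]\<close> or
  \<open>[2/3, 1]\<close>, where \<open>digit_wave\<close> is constant.\<close>

definition ternary_sum :: "(nat \<Rightarrow> int) \<Rightarrow> real" where
  "ternary_sum b = (\<Sum>j. 2 * of_int (b j) / 3 ^ Suc j)"

lemma ternary_sum:
  assumes b: "\<And>j. b j \<in> {0, 1}"
  shows "summable (\<lambda>j. 2 * of_int (b j) / (3 ^ Suc j :: real))"
    and "0 \<le> ternary_sum b" and "ternary_sum b \<le> 1"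
    and "ternary_sum b = 2 * of_int (b 0) / 3 + ternary_sum (\<lambda>j. b (Suc j)) / 3"
proof -
  have "(\<lambda>j. 2 / 3 * (1 / 3) ^ j :: real) = (\<lambda>j. 2 / (3 ^ Suc j :: real))"
    by (rule ext) (simp add: power_one_over field_simps)
  then have geo: "(\<lambda>j. 2 / (3 ^ Suc j :: real)) sums 1"
    using sums_mult[OF geometric_sums[of "1/3::real"], of "2/3"] by simp
  have le: "0 \<le> 2 * of_int (b j) / (3 ^ Suc j :: real)" "2 * of_int (b j) / (3 ^ Suc j :: real) \<le> 2 / 3 ^ Suc j" for j
    using b[of j] by auto
  show sm: "summable (\<lambda>j. 2 * of_int (b j) / (3 ^ Suc j :: real))"
    by (rule summable_comparison_test'[OF sums_summable[OF geo], of 0]) (use le in \<open>simp only: real_norm_def abs_of_nonneg\<close>)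
  show "0 \<le> ternary_sum b" unfolding ternary_sum_def by (rule suminf_nonneg[OF sm le(1)])
  show "ternary_sum b \<le> 1" unfolding ternary_sum_def sums_unique[OF geo]
    by (rule suminf_le[OF le(2) sm sums_summable[OF geo]])
  have sm': "summable (\<lambda>j. 2 * of_int (b (Suc j)) / (3 ^ Suc (Suc j) :: real))"
    using sm by (subst (asm) summable_Suc_iff[symmetric])
  have "summable (\<lambda>j. 3 * (2 * of_int (b (Suc j)) / (3 ^ Suc (Suc j) :: real)))"
    by (rule summable_mult[OF sm'])
  then have sm'': "summable (\<lambda>j. 2 * of_int (b (Suc j)) / (3 ^ Suc j :: real))" by simp
  have "(\<Sum>j. 2 * of_int (b (Suc j)) / (3 ^ Suc j :: real) / 3) = ternary_sum (\<lambda>j. b (Suc j)) / 3"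
    unfolding ternary_sum_def by (rule suminf_divide[OF sm''])
  moreover have "(\<Sum>j. 2 * of_int (b (Suc j)) / (3 ^ Suc j :: real) / 3) = (\<Sum>j. 2 * of_int (b (Suc j)) / (3 ^ Suc (Suc j) :: real))"
    by (simp add: mult_ac)
  ultimately show "ternary_sum b = 2 * of_int (b 0) / 3 + ternary_sum (\<lambda>j. b (Suc j)) / 3"
    using suminf_split_head[OF sm] unfolding ternary_sum_def by simp
qed

lemma cos_pi_add_even: "cos (pi * (2 * of_int N + x)) = cos (pi * x)" for N :: int
proof -
  have "pi * (2 * of_int N + x) = pi * x + 2 * pi * of_int N" by (simp add: algebra_simps)
  then show ?thesis using cos_add[of "pi * x" "2 * pi * of_int N"]
    by (simp add: cos_int_2pin sin_int_2pin)
qed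

text \<open>Multiplication by \<open>3 ^ m\<close> moves the first \<open>m\<close> digits in front
  of the point. Being \<open>0\<close> or \<open>2\<close> they form an even integer, invisible to a
  wave of period 2, and the tail starts with the digit \<open>2 * b m\<close>.\<close>

lemma digit_wave_ternary_sum:
  assumes b: "\<And>j. b j \<in> {0, 1}"
  shows "digit_wave (3 ^ m * ternary_sum b) = of_int (b m)"
proof -
  have "\<exists>N::int. 3 ^ m * ternary_sum b = 2 * of_int N + ternary_sum (\<lambda>j. b (j + m))"
  proof (induction m)
    case 0
    show ?case by (rule exI[of _ 0]) simp
  next
    case (Suc m)
    then obtain N :: int where N: "3 ^ m * ternary_sum b = 2 * of_int N + ternary_sum (\<lambda>j. b (j + m))" by blast
    have "ternary_sum (\<lambda>j. b (j + m)) = 2 * of_int (b m) / 3 + ternary_sum (\<lambda>j. b (j + Suc m)) / 3"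
      using ternary_sum(4)[of "\<lambda>j. b (j + m)"] b by simp
    then have "3 ^ Suc m * ternary_sum b = 2 * of_int (3 * N + b m) + ternary_sum (\<lambda>j. b (j + Suc m))"
      using N by (simp add: field_simps)
    then show ?case by blast
  qed
  then obtain N :: int where N: "3 ^ m * ternary_sum b = 2 * of_int N + ternary_sum (\<lambda>j. b (j + m))" by blast
  define t where "t = ternary_sum (\<lambda>j. b (j + m))"
  define r where "r = ternary_sum (\<lambda>j. b (Suc j + m)) / 3"
  have t: "t = 2 * of_int (b m) / 3 + r"
    using ternary_sum(4)[of "\<lambda>j. b (j + m)"] b by (simp add: t_def r_def)
  have r: "0 \<le> r" "r \<le> 1/3" using ternary_sum(2,3)[of "\<lambda>j. b (Suc j + m)"] b by (auto simp: r_def)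
  have eq: "cos (pi * (3 ^ m * ternary_sum b)) = cos (pi * t)"
    unfolding N t_def[symmetric] by (rule cos_pi_add_even)
  consider "b m = 0" "cos (pi * t) \<ge> 1/2" | "b m = 1" "cos (pi * t) \<le> - 1/2"
  proof -
    consider "b m = 0" | "b m = 1" using b[of m] by auto
    then show thesis
    proof cases
      case 1
      have "cos (pi / 3) \<le> cos (pi * t)"
        by (rule cos_monotone_0_pi_le) (use t 1 r in \<open>auto simp: field_simps\<close>)
      then show thesis using that(1) 1 by (simp add: cos_60)
    next
      case 2
      have "pi * (2/3) \<le> pi * t" "pi * t \<le> pi * 1" using 2 t r by (auto intro!: mult_left_mono)
      then have "cos (pi * t) \<le> cos (pi * (2/3))"
        by (intro cos_monotone_0_pi_le) auto
      also have "\<dots> = - 1/2"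
      proof -
        have "pi * (2/3) = pi - pi / 3" by simp
        then show ?thesis by (metis cos_60 cos_pi_minus minus_divide_left)
      qed
      finally show thesis using that(2) 2 by simp
    qed
  qed
  then show ?thesis unfolding digit_wave_def eq by cases auto
qed

text \<open>Schoenberg's space-filling curve. Its value at the number with ternary digits \<open>2 b\<^sub>m\<close> has
  coordinates whose binary digits are read off from the subsequences of \<open>b\<close> selected by
  \<^const>\<open>prod_encode\<close>; this makes the section Borel measurable.\<close>

lemma continuous_surjection_with_section:
  fixes S :: "'a::euclidean_space set"
  assumes "bounded S"
  obtains c :: "real \<Rightarrow> 'a" and s :: "'a \<Rightarrow> real"
  where "continuous_on UNIV c" "bounded (range c)" "s \<in> borel_measurable borel" "range s \<subseteq> {0..1}"
    "\<And>y. y \<in> S \<Longrightarrow> c (s y) = y"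
proof -
  obtain B where B: "B > 0" "\<And>y. y \<in> S \<Longrightarrow> norm y \<le> B"
    using assms bounded_pos by metis
  obtain e :: "'a \<Rightarrow> nat" where e: "inj_on e Basis"
    using finite_imp_inj_to_nat_seg[of "Basis :: 'a set"] by auto
  \<comment> \<open>Sends the coordinate range \<open>[-B, B]\<close> into
    \<open>[1/4, 3/4]\<close>, safely below \<open>1\<close>, where the binary expansion by floors
    would fail. The definition of \<open>c\<close> inverts this affine map.\<close>
  define u where "u b y = (y \<bullet> b + 2 * B) / (4 * B)" for b y :: 'a
  \<comment> \<open>One bit sequence carries the digits of all coordinates. Where \<open>i\<close>
    numbers no coordinate, \<open>inv_into\<close> returns an unspecified vector, but the bit is
    still \<open>0\<close> or \<open>1\<close>, as \<open>ternary_sum\<close> requires.\<close>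
  define D where "D y m = (case prod_decode m of (i, k) \<Rightarrow> binary_digit (u (inv_into Basis e i) y) k)" for y m
  define w where "w i t = (\<Sum>k. digit_wave (3 ^ prod_encode (i, k) * t) / 2 ^ Suc k)" for i t
  define c where "c t = (\<Sum>b\<in>Basis. (4 * B * w (e b) t - 2 * B) *\<^sub>R b)" for t
  define s where "s y = ternary_sum (D y)" for y
  have D: "D y m \<in> {0, 1}" for y m
    by (cases "prod_decode m") (use binary_digit_cases in \<open>auto simp: D_def\<close>)
  have geo: "(\<lambda>k. 1 / (2 ^ Suc k :: real)) sums 1"
    using power_half_series by (simp only: power_one_over)
  have wb: "norm (digit_wave (3 ^ prod_encode (i, k) * t) / 2 ^ Suc k) \<le> 1 / 2 ^ Suc k" for i k t
    using digit_wave_bounds[of "3 ^ prod_encode (i, k) * t"] by (simp add: divide_right_mono)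
  have wsm: "summable (\<lambda>k. digit_wave (3 ^ prod_encode (i, k) * t) / 2 ^ Suc k)" for i t
    by (rule summable_comparison_test'[OF sums_summable[OF geo], of 0]) (use wb in blast)
  have wcont: "continuous_on UNIV (w i)" for i
  proof -
    have ul: "uniform_limit UNIV (\<lambda>n t. \<Sum>k<n. digit_wave (3 ^ prod_encode (i, k) * t) / 2 ^ Suc k) (w i) sequentially"
      unfolding w_def by (rule Weierstrass_m_test[OF _ sums_summable[OF geo]]) (use wb in blast)
    show ?thesis
      by (rule uniform_limit_theorem[OF always_eventually ul])
        (auto intro!: continuous_on_sum continuous_on_divide continuous_on_digit_wave continuous_on_mult_left)
  qed
  have w01: "0 \<le> w i t" "w i t \<le> 1" for i t
  proof -
    show "0 \<le> w i t" unfolding w_def by (rule suminf_nonneg[OF wsm]) (simp add: digit_wave_bounds)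
    have "w i t \<le> (\<Sum>k. 1 / 2 ^ Suc k)" unfolding w_def
      by (rule suminf_le[OF _ wsm sums_summable[OF geo]]) (use abs_le_D1[OF wb[unfolded real_norm_def]] in blast)
    then show "w i t \<le> 1" by (simp only: sums_unique[OF geo, symmetric])
  qed
  have "continuous_on UNIV c" unfolding c_def by (intro continuous_intros wcont)
  moreover have "bounded (range c)"
  proof (rule boundedI)
    fix x assume "x \<in> range c"
    then obtain t where x: "x = c t" by blast
    have "norm (c t) \<le> (\<Sum>b\<in>(Basis::'a set). 2 * B)" unfolding c_def
    proof (rule sum_norm_le)
      fix b :: 'a assume b: "b \<in> Basis"
      have "0 \<le> 4 * B * w (e b) t" "4 * B * w (e b) t \<le> 4 * B * 1"
        using w01[of "e b" t] B(1) by (auto intro!: mult_left_mono)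
      then show "norm ((4 * B * w (e b) t - 2 * B) *\<^sub>R b) \<le> 2 * B" using b by simp
    qed
    then show "norm x \<le> (\<Sum>b\<in>(Basis::'a set). 2 * B)" unfolding x .
  qed
  moreover have "s \<in> borel_measurable borel"
  proof -
    have "(\<lambda>y. real_of_int (D y m)) \<in> borel_measurable borel" for m
      unfolding D_def u_def binary_digit_def by (cases "prod_decode m") simp
    then show ?thesis unfolding s_def ternary_sum_def by measurable
  qed
  moreover have "range s \<subseteq> {0..1}"
    using ternary_sum(2,3) D unfolding s_def by auto
  moreover have "c (s y) = y" if "y \<in> S" for y
  proof -
    have "w (e b) (s y) = u b y" if b: "b \<in> Basis" for b
    proof -
      have "\<bar>y \<bullet> b\<bar> \<le> B" using B(2)[OF \<open>y \<in> S\<close>] Basis_le_norm[OF b, of y] by linarith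
      then have "0 \<le> u b y" "u b y < 1" using B(1) unfolding u_def by (auto simp: field_simps)
      from binary_digit_sums[OF this] have "(\<Sum>k. of_int (binary_digit (u b y) k) / 2 ^ Suc k) = u b y"
        by (rule sums_unique[symmetric])
      moreover have "D y (prod_encode (e b, k)) = binary_digit (u b y) k" for k
        unfolding D_def using b e by simp
      ultimately show ?thesis unfolding w_def s_def digit_wave_ternary_sum[of "D y", OF D] by simp
    qed
    then have "c (s y) = (\<Sum>b\<in>Basis. (4 * B * u b y - 2 * B) *\<^sub>R b)" unfolding c_def by simp
    also have "\<dots> = (\<Sum>b\<in>Basis. (y \<bullet> b) *\<^sub>R b)" unfolding u_def using B(1) by simp
    finally show ?thesis by (simp add: euclidean_representation)
  qed
  ultimately show ?thesis using that by blast
qed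

section \<open>Selection of weakly convergent subsequences\<close>

text \<open>The curve moves the problem to the line. The laws of \<open>s\<close> are carried by
  \<open>[0, 1]\<close>, so tightness yields a limit \<open>M\<close> along a subsequence, and
  \<open>\<nu>\<close> is its image under \<open>c\<close>. Only \<open>c\<close> has to be
  continuous: \<open>h \<circ> c\<close> is a bounded continuous test function, and the Borel map
  \<open>s\<close> serves to write \<open>\<mu> k\<close> as an image.\<close>

theorem prob_measures_weakly_compact:
  fixes \<mu> :: "nat \<Rightarrow> 'a::euclidean_space measure"
  assumes S: "compact S" "S \<noteq> {}"
    and prob: "\<And>k. prob_space (\<mu> k)" and sets: "\<And>k. sets (\<mu> k) = sets borel"
    and supp: "\<And>k. AE \<xi> in \<mu> k. \<xi> \<in> S"
  obtains r :: "nat \<Rightarrow> nat" and \<nu> :: "'a measure"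
  where "strict_mono r" "prob_space \<nu>" "sets \<nu> = sets borel" "AE \<xi> in \<nu>. \<xi> \<in> S"
    "\<And>h :: 'a \<Rightarrow> real. continuous_on UNIV h \<Longrightarrow> (\<lambda>k. \<integral>\<xi>. h \<xi> \<partial>\<mu> (r k)) \<longlonglongrightarrow> (\<integral>\<xi>. h \<xi> \<partial>\<nu>)"
proof -
  obtain c :: "real \<Rightarrow> 'a" and s :: "'a \<Rightarrow> real"
    where c: "continuous_on UNIV c" "bounded (range c)" and s: "s \<in> borel_measurable borel" "range s \<subseteq> {0..1}"
      and cs: "\<And>y. y \<in> S \<Longrightarrow> c (s y) = y"
    using continuous_surjection_with_section[OF compact_imp_bounded[OF S(1)]] by blast
  have cm [measurable]: "c \<in> borel_measurable borel" by (rule borel_measurable_continuous_onI[OF c(1)])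
  have sm: "s \<in> borel_measurable (\<mu> k)" for k
    using s(1) measurable_cong_sets[OF sets refl] by blast
  define L where "L k = distr (\<mu> k) borel s" for k
  have rd: "real_distribution (L k)" for k
    unfolding real_distribution_def real_distribution_axioms_def L_def
    using prob_space.prob_space_distr[OF prob sm] by simp
  \<comment> \<open>\<open>tight\<close> is phrased with intervals open on the left, so the left end
    has to lie strictly below the possible value \<open>0\<close>.\<close>
  have "measure (L k) {-1<..1} = 1" for k
  proof -
    interpret prob_space "\<mu> k" by (rule prob)
    have "s -` {-1<..1} \<inter> space (\<mu> k) = space (\<mu> k)" using s(2) by force
    then show ?thesis unfolding L_def by (simp add: measure_distr[OF sm] prob_space)
  qed
  then have "tight L" unfolding tight_def using rd
    by (intro conjI allI impI exI[of _ "-1"] exI[of _ "1::real"]) auto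
  from tight_imp_convergent_subsubsequence[OF this strict_mono_id]
  obtain r M where r: "strict_mono r" and M: "real_distribution M" and conv: "weak_conv_m (L \<circ> id \<circ> r) M"
    by blast
  interpret M: real_distribution M by (rule M)
  define \<nu> where "\<nu> = distr M borel c"
  have cM: "c \<in> borel_measurable M" using cm measurable_cong_sets[OF M.events_eq_borel refl] by blast
  have lim: "(\<lambda>k. \<integral>\<xi>. h \<xi> \<partial>\<mu> (r k)) \<longlonglongrightarrow> (\<integral>\<xi>. h \<xi> \<partial>\<nu>)" if h: "continuous_on UNIV h" for h :: "'a \<Rightarrow> real"
  proof -
    have hm [measurable]: "h \<in> borel_measurable borel" by (rule borel_measurable_continuous_onI[OF h])
    have hc: "continuous_on UNIV (\<lambda>t. h (c t))"
      by (rule continuous_on_compose2[OF h c(1)]) auto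
    have "compact (h ` closure (range c))"
      by (rule compact_continuous_image[OF continuous_on_subset[OF h]]) (use c(2) in auto)
    then obtain B where "\<And>z. z \<in> h ` closure (range c) \<Longrightarrow> norm z \<le> B"
      using compact_imp_bounded bounded_iff by metis
    then have B: "norm (h (c t)) \<le> B" for t
      using closure_subset[of "range c"] by blast
    interpret S: prob_space "L k" for k using rd by (simp add: real_distribution_def)
    have "(\<lambda>k. \<integral>t. h (c t) \<partial>(L \<circ> id \<circ> r) k) \<longlonglongrightarrow> (\<integral>t. h (c t) \<partial>M)"
      by (rule weak_conv_imp_integral_bdd_continuous_conv[OF _ M conv _ B])
        (use rd hc in \<open>auto simp: continuous_on_eq_continuous_at\<close>)
    moreover have "(\<integral>t. h (c t) \<partial>L k) = (\<integral>\<xi>. h \<xi> \<partial>\<mu> k)" for k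
    proof -
      have [measurable_cong]: "sets (\<mu> k) = sets borel" by (rule sets)
      note s(1)[measurable]
      have "(\<integral>t. h (c t) \<partial>L k) = (\<integral>\<xi>. h (c (s \<xi>)) \<partial>\<mu> k)"
        unfolding L_def by (rule integral_distr[OF sm]) measurable
      also have "\<dots> = (\<integral>\<xi>. h \<xi> \<partial>\<mu> k)"
        by (rule integral_cong_AE) (use supp[of k] cs in \<open>auto elim!: eventually_mono\<close>)
      finally show ?thesis .
    qed
    moreover have "(\<integral>\<xi>. h \<xi> \<partial>\<nu>) = (\<integral>t. h (c t) \<partial>M)"
      unfolding \<nu>_def by (rule integral_distr[OF cM]) measurable
    ultimately show ?thesis by simp
  qed
  have p\<nu>: "prob_space \<nu>" unfolding \<nu>_def by (rule M.prob_space_distr[OF cM])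
  have s\<nu>: "sets \<nu> = sets borel" by (simp add: \<nu>_def)
  \<comment> \<open>The curve may leave \<open>S\<close>, so the support is recovered from the limit
    itself: the continuous function \<open>infdist \<xi> S\<close> has integral \<open>0\<close>
    against every \<open>\<mu> k\<close>.\<close>
  have "AE \<xi> in \<nu>. \<xi> \<in> S"
  proof -
    have ci: "continuous_on UNIV (\<lambda>\<xi>. infdist \<xi> S)" by (intro continuous_intros)
    have "(\<integral>\<xi>. infdist \<xi> S \<partial>\<mu> k) = 0" for k
      by (rule integral_eq_zero_AE) (use supp[of k] in \<open>auto elim!: eventually_mono\<close>)
    with lim[OF ci] have "(\<integral>\<xi>. infdist \<xi> S \<partial>\<nu>) = 0"
      by (simp add: LIMSEQ_const_iff)
    moreover have "integrable \<nu> (\<lambda>\<xi>. infdist \<xi> S)"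
    proof -
      have "compact ((\<lambda>\<xi>. infdist \<xi> S) ` closure (range c))"
        by (rule compact_continuous_image[OF continuous_on_subset[OF ci]]) (use c(2) in auto)
      then obtain B where "\<And>z. z \<in> (\<lambda>\<xi>. infdist \<xi> S) ` closure (range c) \<Longrightarrow> norm z \<le> B"
        using compact_imp_bounded bounded_iff by metis
      then have B: "norm (infdist (c t) S) \<le> B" for t
        using closure_subset[of "range c"] by blast
      have "integrable M (\<lambda>t. infdist (c t) S)"
        by (rule M.integrable_const_bound[of _ B]) (use B in \<open>auto intro!: measurable_compose[OF cM] borel_measurable_continuous_onI[OF ci]\<close>)
      then show ?thesis unfolding \<nu>_def
        by (subst integrable_distr_eq[OF cM]) (auto intro!: borel_measurable_continuous_onI[OF ci])
    qed
    ultimately have "AE \<xi> in \<nu>. infdist \<xi> S = 0"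
      by (subst (asm) integral_nonneg_eq_0_iff_AE) (auto simp: infdist_nonneg)
    then show ?thesis
      using in_closed_iff_infdist_zero[OF compact_imp_closed[OF S(1)] S(2)] by (auto elim!: eventually_mono)
  qed
  then show ?thesis using that r p\<nu> s\<nu> lim by blast
qed

section \<open>Logarithmic moments of Gaussian vectors\<close>

text \<open>For small \<open>u\<close> this is \<open>ln v \<le> v\<close> at
  \<open>v = u powr (-1/2)\<close>; the exponent is chosen so that the majorant is integrable at
  \<open>0\<close>.\<close>

lemma abs_ln_le:
  fixes u :: real
  assumes "0 < u"
  shows "\<bar>ln u\<bar> \<le> u + (if u \<le> 1 then 2 * u powr (-1/2) else 0)"
proof (cases "u \<le> 1")
  case True
  have "ln (u powr (-1/2)) \<le> u powr (-1/2)"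
    using ln_bound[of "u powr (-1/2)"] assms by simp
  then have "- ln u \<le> 2 * u powr (-1/2)" using assms by (simp add: ln_powr)
  moreover have "ln u \<le> 0" using True assms by simp
  ultimately show ?thesis using assms True by simp
next
  case False
  then show ?thesis using ln_bound[of u] assms by simp
qed

lemma integrable_ln_abs_normal:
  "integrable lborel (\<lambda>z. std_normal_density z * ln \<bar>z\<bar>)"
proof -
  \<comment> \<open>Half of the majorant near the singularity, where the density is estimated by
    \<open>1\<close>; its reflection covers negative \<open>z\<close>.\<close>
  define g where "g z = indicator {0..1} z * (2 * z powr (-1/2))" for z :: real
  have "(\<lambda>x. x powr (-1/2)) integrable_on {0..(1::real)}"
    using has_integral_powr_from_0[of "-1/2" 1] by (auto simp: integrable_on_def)
  then have "(\<lambda>x. x powr (-1/2)) absolutely_integrable_on {0..(1::real)}"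
    by (rule nonnegative_absolutely_integrable_1) auto
  then have "integrable lebesgue (\<lambda>x. indicator {0..(1::real)} x *\<^sub>R x powr (-1/2))"
    by (simp add: set_integrable_def)
  then have "integrable lborel (\<lambda>x. indicator {0..(1::real)} x *\<^sub>R x powr (-1/2))"
    by (subst (asm) integrable_completion) auto
  from integrable_mult_right[OF this, of 2] have g: "integrable lborel g"
    unfolding g_def by (simp add: mult_ac)
  have g': "integrable lborel (\<lambda>z. g (- z))"
    using lborel_integrable_real_affine[OF g, of "-1" 0] by simp
  have m: "integrable lborel (\<lambda>z. std_normal_density z * \<bar>z\<bar>)"
    using integrable_std_normal_moment_abs[of 1] by simp
  show ?thesis
  proof (rule Bochner_Integration.integrable_bound[OF Bochner_Integration.integrable_add[OF m Bochner_Integration.integrable_add[OF g g']]])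
    have "norm (std_normal_density z * ln \<bar>z\<bar>) \<le> norm (std_normal_density z * \<bar>z\<bar> + (g z + g (- z)))" for z
    proof (cases "z = 0")
      case False
      define h where "h = (if \<bar>z\<bar> \<le> 1 then 2 * \<bar>z\<bar> powr (-1/2) else 0)"
      have h0: "h \<ge> 0" by (simp add: h_def)
      have gh: "g z + g (- z) = h" using False by (auto simp: g_def h_def indicator_def)
      have d: "std_normal_density z \<le> 1"
      proof -
        have "1 / sqrt (2 * pi) \<le> 1" using pi_gt3 by simp
        moreover have "exp (- z\<^sup>2 / 2) \<le> 1" by simp
        ultimately show ?thesis unfolding std_normal_density_def
          by (metis exp_ge_zero mult_le_one)
      qed
      have "std_normal_density z * \<bar>ln \<bar>z\<bar>\<bar> \<le> std_normal_density z * (\<bar>z\<bar> + h)"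
        using abs_ln_le[of "\<bar>z\<bar>"] False by (intro mult_left_mono) (auto simp: h_def)
      also have "\<dots> \<le> std_normal_density z * \<bar>z\<bar> + h"
        using mult_right_mono[OF d h0] by (simp add: algebra_simps)
      finally show ?thesis using gh h0 by (simp add: abs_mult)
    qed simp
    then show "AE z in lborel. norm (std_normal_density z * ln \<bar>z\<bar>) \<le> norm (std_normal_density z * \<bar>z\<bar> + (g z + g (- z)))"
      by simp
  qed simp
qed

section \<open>Gaussian vectors and their linear forms\<close>

text \<open>The index type varies: \<open>'n option\<close> carries the pair
  \<open>(N\<^sub>0, N)\<close>, while \<open>'n\<close> carries a second Gaussian vector used to
  linearise Euclidean norms.\<close>

definition gauss :: "('i::finite \<Rightarrow> real) measure" where
  "gauss = PiM UNIV (\<lambda>_. density lborel std_normal_density)"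

lemma sets_gauss [measurable_cong]: "sets gauss = sets (PiM UNIV (\<lambda>_::'i::finite. borel :: real measure))"
  unfolding gauss_def by (intro sets_PiM_cong) auto

lemma space_gauss [simp]: "space gauss = UNIV"
  by (simp add: gauss_def space_PiM PiE_UNIV_domain)

lemma prob_space_gauss: "prob_space gauss"
  unfolding gauss_def by (intro prob_space_PiM prob_space_normal_density) simp

interpretation gauss: prob_space "gauss :: ('i::finite \<Rightarrow> real) measure"
  by (rule prob_space_gauss)

lemma gauss_prob [simp]: "measure gauss (UNIV :: ('i::finite \<Rightarrow> real) set) = 1"
  using gauss.prob_space by simp

lemma gauss_component:
  "distributed gauss lborel (\<lambda>\<omega>. \<omega> (i::'i::finite)) std_normal_density"
proof -
  have "distr gauss lborel (\<lambda>\<omega>. \<omega> i) = distr gauss (density lborel std_normal_density) (\<lambda>\<omega>. \<omega> i)"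
    by (rule distr_cong) auto
  also have "\<dots> = density lborel std_normal_density" unfolding gauss_def
    by (rule distr_PiM_component) (auto intro: prob_space_normal_density)
  finally show ?thesis unfolding distributed_def by (auto simp: )
qed

lemma gauss_indep: "gauss.indep_vars (\<lambda>_. borel) (\<lambda>i \<omega>. \<omega> i) (UNIV :: 'i::finite set)"
proof (subst gauss.indep_vars_iff_distr_eq_PiM')
  have 1: "distr gauss borel (\<lambda>\<omega>. \<omega> i) = density lborel std_normal_density" for i :: 'i
    using gauss_component[of i] unfolding distributed_def
    by (metis distr_cong sets_lborel)
  have 2: "distr gauss (PiM UNIV (\<lambda>_. borel)) (\<lambda>\<omega>. \<omega>) = (gauss :: ('i \<Rightarrow> real) measure)"
    by (rule distr_id2) (rule sets_gauss[symmetric])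
  show "distr gauss (PiM UNIV (\<lambda>i. borel)) (\<lambda>x. \<lambda>i\<in>UNIV. x i) =
    PiM UNIV (\<lambda>i. distr gauss borel (\<lambda>\<omega>. \<omega> (i::'i)))"
    unfolding 1 by (simp add: 2 restrict_def) (simp add: gauss_def)
qed auto

lemma gauss_linear:
  fixes a :: "'i::finite \<Rightarrow> real"
  assumes "a \<noteq> (\<lambda>_. 0)"
  shows "distributed gauss lborel (\<lambda>\<omega>. \<Sum>i\<in>UNIV. a i * \<omega> i) (normal_density 0 (sqrt (\<Sum>i\<in>UNIV. (a i)\<^sup>2)))"
proof -
  \<comment> \<open>Terms with coefficient \<open>0\<close> are dropped because a degenerate normal
    variable has no density.\<close>
  define I where "I = {i. a i \<noteq> 0}"
  have I: "finite I" "I \<noteq> {}" using assms by (auto simp: I_def)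
  have indep: "gauss.indep_vars (\<lambda>_. borel) (\<lambda>i. (\<lambda>x. a i * x) \<circ> (\<lambda>\<omega>. \<omega> i)) I"
    by (rule gauss.indep_vars_compose[OF gauss.indep_vars_subset[OF gauss_indep]]) auto
  have d: "distributed gauss lborel (\<lambda>\<omega>. a i * \<omega> i) (normal_density 0 \<bar>a i\<bar>)" if "i \<in> I" for i
    using gauss.normal_density_affine[OF gauss_component[of i], of "a i" 0] that by (simp add: I_def)
  have "distributed gauss lborel (\<lambda>\<omega>. \<Sum>i\<in>I. a i * \<omega> i) (normal_density (\<Sum>i\<in>I. 0) (sqrt (\<Sum>i\<in>I. \<bar>a i\<bar>\<^sup>2)))"
    by (rule gauss.sum_indep_normal[OF I]) (use indep d in \<open>auto simp: I_def comp_def\<close>)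
  moreover have "(\<Sum>i\<in>I. a i * \<omega> i) = (\<Sum>i\<in>UNIV. a i * \<omega> i)" for \<omega>
    by (rule sum.mono_neutral_left) (auto simp: I_def)
  moreover have "(\<Sum>i\<in>I. \<bar>a i\<bar>\<^sup>2) = (\<Sum>i\<in>UNIV. (a i)\<^sup>2)"
    by (simp, rule sum.mono_neutral_left) (auto simp: I_def)
  ultimately show ?thesis by simp
qed

definition gauss_ln_mean :: real where
  "gauss_ln_mean = (\<integral>z. std_normal_density z * ln \<bar>z\<bar> \<partial>lborel)"

definition gauss_abs_ln_mean :: real where
  "gauss_abs_ln_mean = (\<integral>z. std_normal_density z * \<bar>ln \<bar>z\<bar>\<bar> \<partial>lborel)"

context
  fixes a :: "'i::finite \<Rightarrow> real" and s :: real
  assumes s: "s = sqrt (\<Sum>i\<in>UNIV. (a i)\<^sup>2)" "s \<noteq> 0"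
begin

lemma scale_pos: "0 < s"
  using s sum_nonneg[of UNIV "\<lambda>i. (a i)\<^sup>2"] by (simp add: less_le)

lemma gauss_standardized:
  "distributed gauss lborel (\<lambda>\<omega>. (\<Sum>i\<in>UNIV. a i * \<omega> i) / s) std_normal_density"
proof -
  have "a \<noteq> (\<lambda>_. 0)" using s by auto
  from gauss_linear[OF this] show ?thesis
    using gauss.normal_standard_normal_convert[of s "\<lambda>\<omega>. (\<Sum>i\<in>UNIV. a i * \<omega> i)" 0] scale_pos s(1) by simp
qed

lemma gauss_linear_nonzero: "AE \<omega> in gauss. (\<Sum>i\<in>UNIV. a i * \<omega> i) \<noteq> 0"
proof -
  have "AE z in density lborel std_normal_density. z \<noteq> (0::real)"
    by (subst AE_density) (auto intro: AE_mp[OF AE_lborel_singleton[of 0]])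
  then have "AE z in distr gauss lborel (\<lambda>\<omega>. (\<Sum>i\<in>UNIV. a i * \<omega> i) / s). z \<noteq> 0"
    unfolding distributed_distr_eq_density[OF gauss_standardized] .
  then have "AE \<omega> in gauss. (\<Sum>i\<in>UNIV. a i * \<omega> i) / s \<noteq> 0"
    by (subst (asm) AE_distr_iff) auto
  then show ?thesis by eventually_elim auto
qed

lemma gauss_ln_standardized:
  shows "integrable gauss (\<lambda>\<omega>. ln \<bar>(\<Sum>i\<in>UNIV. a i * \<omega> i) / s\<bar>)"
    and "(\<integral>\<omega>. ln \<bar>(\<Sum>i\<in>UNIV. a i * \<omega> i) / s\<bar> \<partial>gauss) = gauss_ln_mean"
    and "(\<integral>\<omega>. \<bar>ln \<bar>(\<Sum>i\<in>UNIV. a i * \<omega> i) / s\<bar>\<bar> \<partial>gauss) = gauss_abs_ln_mean"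
  using distributed_integrable[OF gauss_standardized, of "\<lambda>z. ln \<bar>z\<bar>"] integrable_ln_abs_normal
    distributed_integral[OF gauss_standardized, of "\<lambda>z. ln \<bar>z\<bar>"]
    distributed_integral[OF gauss_standardized, of "\<lambda>z. \<bar>ln \<bar>z\<bar>\<bar>"]
  by (simp_all add: gauss_ln_mean_def gauss_abs_ln_mean_def)

lemma gauss_ln_split:
  "AE \<omega> in gauss. ln \<bar>\<Sum>i\<in>UNIV. a i * \<omega> i\<bar> = ln s + ln \<bar>(\<Sum>i\<in>UNIV. a i * \<omega> i) / s\<bar>"
  using gauss_linear_nonzero
  by eventually_elim (use scale_pos in \<open>simp add: ln_div\<close>)

text \<open>The form is \<open>s Z\<close> with \<open>Z\<close> standard normal, so its logarithm
  is \<open>ln s + ln |Z|\<close> and the direction of \<open>a\<close> disappears. The absolute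
  moment is kept for Fubini's theorem.\<close>

lemma gauss_ln:
  shows "integrable gauss (\<lambda>\<omega>. ln \<bar>\<Sum>i\<in>UNIV. a i * \<omega> i\<bar>)"
    and "(\<integral>\<omega>. ln \<bar>\<Sum>i\<in>UNIV. a i * \<omega> i\<bar> \<partial>gauss) = ln s + gauss_ln_mean"
    and "(\<integral>\<omega>. \<bar>ln \<bar>\<Sum>i\<in>UNIV. a i * \<omega> i\<bar>\<bar> \<partial>gauss) \<le> \<bar>ln s\<bar> + gauss_abs_ln_mean"
proof -
  have i: "integrable gauss (\<lambda>\<omega>. ln s + ln \<bar>(\<Sum>i\<in>UNIV. a i * \<omega> i) / s\<bar>)"
    using gauss_ln_standardized(1) by simp
  show int: "integrable gauss (\<lambda>\<omega>. ln \<bar>\<Sum>i\<in>UNIV. a i * \<omega> i\<bar>)"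
    using i by (rule integrable_cong_AE_imp) (use gauss_ln_split in auto)
  have "(\<integral>\<omega>. ln \<bar>\<Sum>i\<in>UNIV. a i * \<omega> i\<bar> \<partial>gauss) = (\<integral>\<omega>. ln s + ln \<bar>(\<Sum>i\<in>UNIV. a i * \<omega> i) / s\<bar> \<partial>gauss)"
    by (rule integral_cong_AE) (use gauss_ln_split in auto)
  also have "\<dots> = ln s + gauss_ln_mean"
    using gauss_ln_standardized by (simp add: gauss_prob)
  finally show "(\<integral>\<omega>. ln \<bar>\<Sum>i\<in>UNIV. a i * \<omega> i\<bar> \<partial>gauss) = ln s + gauss_ln_mean" .
  have "(\<integral>\<omega>. \<bar>ln \<bar>\<Sum>i\<in>UNIV. a i * \<omega> i\<bar>\<bar> \<partial>gauss) \<le> (\<integral>\<omega>. \<bar>ln s\<bar> + \<bar>ln \<bar>(\<Sum>i\<in>UNIV. a i * \<omega> i) / s\<bar>\<bar> \<partial>gauss)"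
    by (rule integral_mono_AE)
      (use int gauss_ln_standardized(1) gauss_ln_split in \<open>auto elim!: eventually_mono simp del: abs_divide\<close>)
  also have "\<dots> = \<bar>ln s\<bar> + gauss_abs_ln_mean"
    using gauss_ln_standardized by (simp add: gauss_prob)
  finally show "(\<integral>\<omega>. \<bar>ln \<bar>\<Sum>i\<in>UNIV. a i * \<omega> i\<bar>\<bar> \<partial>gauss) \<le> \<bar>ln s\<bar> + gauss_abs_ln_mean" .
qed

end

lemma gauss_integrable_component: "integrable gauss (\<lambda>\<omega>. \<bar>\<omega> (i::'i::finite)\<bar>)"
  using distributed_integrable[OF gauss_component[of i], of abs] integrable_std_normal_moment_abs[of 1]
  by simp

text \<open>Large vectors are controlled by \<open>ln t \<le> t\<close>, small ones by
  \<open>|v \<bullet> e| \<le> norm v\<close>, so integrability of the logarithm of a single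
  marginal is enough.\<close>

lemma integrable_ln_pos_homogeneous:
  fixes g :: "'a::euclidean_space \<Rightarrow> real"
  assumes g: "pos_homogeneous g" and V [measurable]: "V \<in> borel_measurable M"
    and n: "integrable M (\<lambda>\<omega>. norm (V \<omega>))" and e: "norm e = 1"
    and nz: "AE \<omega> in M. V \<omega> \<bullet> e \<noteq> 0" and l: "integrable M (\<lambda>\<omega>. ln \<bar>V \<omega> \<bullet> e\<bar>)"
    and fin: "finite_measure M"
  shows "AE \<omega> in M. V \<omega> \<noteq> 0" and "integrable M (\<lambda>\<omega>. ln (g (V \<omega>)))"
proof -
  interpret finite_measure M by (rule fin)
  have [measurable]: "g \<in> borel_measurable borel" by (rule pos_homogeneous_borel[OF g])
  show "AE \<omega> in M. V \<omega> \<noteq> 0" using nz by eventually_elim auto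
  obtain B where B: "0 \<le> B" "\<And>x. x \<noteq> 0 \<Longrightarrow> \<bar>ln (g x) - ln (norm x)\<bar> \<le> B"
    using pos_homogeneous_ln_bound[OF g] by blast
  have *: "\<bar>ln (g v)\<bar> \<le> B + norm v + \<bar>ln \<bar>v \<bullet> e\<bar>\<bar>" if "v \<bullet> e \<noteq> 0" for v
  proof -
    have v: "v \<noteq> 0" using that by auto
    have "\<bar>v \<bullet> e\<bar> \<le> norm v" using Cauchy_Schwarz_ineq2[of v e] e by simp
    then have "ln \<bar>v \<bullet> e\<bar> \<le> ln (norm v)" using that v by (subst ln_le_cancel_iff) auto
    moreover have "ln (norm v) \<le> norm v" using v ln_bound[of "norm v"] by simp
    ultimately show ?thesis using B(2)[OF v] norm_ge_zero[of v] by linarith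
  qed
  show "integrable M (\<lambda>\<omega>. ln (g (V \<omega>)))"
  proof (rule Bochner_Integration.integrable_bound)
    show "integrable M (\<lambda>\<omega>. B + norm (V \<omega>) + \<bar>ln \<bar>V \<omega> \<bullet> e\<bar>\<bar>)" using n l by simp
    show "AE \<omega> in M. norm (ln (g (V \<omega>))) \<le> norm (B + norm (V \<omega>) + \<bar>ln \<bar>V \<omega> \<bullet> e\<bar>\<bar>)"
      using nz by eventually_elim (use * B(1) in auto)
  qed measurable
qed

lemma borel_measurable_vec:
  fixes f :: "'a \<Rightarrow> 'i::finite \<Rightarrow> real"
  assumes "\<And>i. (\<lambda>x. f x i) \<in> borel_measurable M"
  shows "(\<lambda>x. \<chi> i. f x i) \<in> borel_measurable M"
  by (subst borel_measurable_euclidean_space) (use assms in \<open>auto simp: Basis_vec_def inner_axis\<close>)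

lemma gauss_coordinate_borel [measurable]: "(\<lambda>\<omega>. \<omega> i) \<in> borel_measurable gauss"
  by measurable

definition gauss_vec :: "('n \<Rightarrow> real) \<Rightarrow> real ^ 'n" where
  "gauss_vec \<omega> = (\<chi> i. \<omega> i)"

text \<open>\<open>N\<^sub>0 x + r N\<close>, i.e. \<open>N\<^sub>0\<close> times the Cauchy-distributed perturbation \<open>x + r (N / N\<^sub>0)\<close> of \<open>x\<close>; the
  coordinate \<^const>\<open>None\<close> carries \<open>N\<^sub>0\<close>.\<close>

definition cauchy_vec :: "real ^ 'n \<Rightarrow> real \<Rightarrow> ('n option \<Rightarrow> real) \<Rightarrow> real ^ 'n" where
  "cauchy_vec x r \<omega> = \<omega> None *\<^sub>R x + r *\<^sub>R (\<chi> i. \<omega> (Some i))"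

lemma gauss_vec_borel [measurable]: "gauss_vec \<in> borel_measurable gauss"
  unfolding gauss_vec_def[abs_def] by (intro borel_measurable_vec) measurable

lemma cauchy_vec_borel [measurable]: "cauchy_vec x r \<in> borel_measurable gauss"
proof -
  have [measurable]: "(\<lambda>\<omega>. \<chi> i. \<omega> (Some i)) \<in> borel_measurable (gauss :: ('a option \<Rightarrow> real) measure)"
    by (intro borel_measurable_vec) measurable
  show ?thesis unfolding cauchy_vec_def[abs_def] by measurable
qed

lemma sum_option: "(\<Sum>j\<in>UNIV. f j) = f None + (\<Sum>i\<in>UNIV. f (Some i))"
  for f :: "'i::finite option \<Rightarrow> real"
  by (simp add: UNIV_option_conv sum.reindex)

lemma gauss_vec_inner: "gauss_vec \<omega> \<bullet> y = (\<Sum>i\<in>UNIV. y $ i * \<omega> i)"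
  by (simp add: gauss_vec_def inner_vec_def mult.commute)

lemma cauchy_vec_inner:
  "cauchy_vec x r \<omega> \<bullet> y = (\<Sum>j\<in>UNIV. (case j of None \<Rightarrow> x \<bullet> y | Some i \<Rightarrow> r * y $ i) * \<omega> j)"
  by (simp add: cauchy_vec_def inner_vec_def sum_option inner_add_left sum_distrib_left sum_distrib_right
      sum.distrib algebra_simps)

lemma cauchy_vec_variance:
  "(\<Sum>j\<in>UNIV. (case j of None \<Rightarrow> x \<bullet> y | Some i \<Rightarrow> r * y $ i)\<^sup>2) = (x \<bullet> y)\<^sup>2 + (r * norm y)\<^sup>2"
  by (simp add: sum_option power_mult_distrib sum_distrib_left[symmetric] norm_vec_def L2_set_def sum_nonneg)

lemma norm_vec_eq: "norm y = sqrt (\<Sum>i\<in>UNIV. (y $ i)\<^sup>2)" for y :: "real ^ 'n"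
  by (simp add: norm_vec_def L2_set_def)

lemma gauss_vec_ln:
  assumes "y \<noteq> 0"
  shows "AE \<omega> in gauss. gauss_vec \<omega> \<bullet> y \<noteq> 0"
    and "integrable gauss (\<lambda>\<omega>. ln \<bar>gauss_vec \<omega> \<bullet> y\<bar>)"
    and "(\<integral>\<omega>. ln \<bar>gauss_vec \<omega> \<bullet> y\<bar> \<partial>gauss) = ln (norm y) + gauss_ln_mean"
  unfolding gauss_vec_inner
  using gauss_linear_nonzero[OF norm_vec_eq[of y]] gauss_ln[OF norm_vec_eq[of y]] assms by auto

text \<open>The pairing is a centered linear form in \<open>(N\<^sub>0, N)\<close>, and the
  hypothesis says that its variance is nonzero. For \<open>y\<close> of arbitrary length the
  smoothing radius becomes \<open>r * norm y\<close>.\<close>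

lemma cauchy_vec_ln:
  fixes x y :: "real ^ 'n"
  assumes "(x \<bullet> y)\<^sup>2 + (r * norm y)\<^sup>2 \<noteq> 0"
  shows "AE \<omega> in gauss. cauchy_vec x r \<omega> \<bullet> y \<noteq> 0"
    and "integrable gauss (\<lambda>\<omega>. ln \<bar>cauchy_vec x r \<omega> \<bullet> y\<bar>)"
    and "(\<integral>\<omega>. ln \<bar>cauchy_vec x r \<omega> \<bullet> y\<bar> \<partial>gauss) = smooth_ln (r * norm y) (x \<bullet> y) + gauss_ln_mean"
    and "(\<integral>\<omega>. \<bar>ln \<bar>cauchy_vec x r \<omega> \<bullet> y\<bar>\<bar> \<partial>gauss) \<le> \<bar>smooth_ln (r * norm y) (x \<bullet> y)\<bar> + gauss_abs_ln_mean"
proof -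
  let ?a = "\<lambda>j. case j of None \<Rightarrow> x \<bullet> y | Some i \<Rightarrow> r * y $ i"
  have s: "sqrt ((x \<bullet> y)\<^sup>2 + (r * norm y)\<^sup>2) = sqrt (\<Sum>j\<in>UNIV. (?a j)\<^sup>2)"
    by (simp add: cauchy_vec_variance)
  have nz: "sqrt ((x \<bullet> y)\<^sup>2 + (r * norm y)\<^sup>2) \<noteq> 0" using assms by simp
  show "AE \<omega> in gauss. cauchy_vec x r \<omega> \<bullet> y \<noteq> 0"
    "integrable gauss (\<lambda>\<omega>. ln \<bar>cauchy_vec x r \<omega> \<bullet> y\<bar>)"
    "(\<integral>\<omega>. ln \<bar>cauchy_vec x r \<omega> \<bullet> y\<bar> \<partial>gauss) = smooth_ln (r * norm y) (x \<bullet> y) + gauss_ln_mean"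
    "(\<integral>\<omega>. \<bar>ln \<bar>cauchy_vec x r \<omega> \<bullet> y\<bar>\<bar> \<partial>gauss) \<le> \<bar>smooth_ln (r * norm y) (x \<bullet> y)\<bar> + gauss_abs_ln_mean"
    unfolding cauchy_vec_inner smooth_ln_def
    by (fact gauss_linear_nonzero[OF s nz] gauss_ln[OF s nz])+
qed

lemma gauss_vec_pos_homogeneous:
  fixes g :: "real ^ 'n \<Rightarrow> real"
  assumes g: "pos_homogeneous g"
  shows "AE \<omega> in gauss. gauss_vec \<omega> \<noteq> (0 :: real ^ 'n)" "integrable gauss (\<lambda>\<omega>. ln (g (gauss_vec \<omega>)))"
proof -
  \<comment> \<open>Merely names a coordinate; its axis vector plays the role of \<open>e\<close> in
    \<open>integrable_ln_pos_homogeneous\<close>.\<close>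
  obtain i :: 'n where True by simp
  have "integrable gauss (\<lambda>\<omega>. norm (gauss_vec \<omega> :: real ^ 'n))"
  proof (rule Bochner_Integration.integrable_bound)
    show "integrable gauss (\<lambda>\<omega>. \<Sum>i\<in>UNIV. \<bar>\<omega> (i::'n)\<bar>)"
      by (intro Bochner_Integration.integrable_sum gauss_integrable_component)
    show "AE \<omega> in gauss. norm (norm (gauss_vec \<omega> :: real ^ 'n)) \<le> norm (\<Sum>i\<in>UNIV. \<bar>\<omega> i\<bar>)"
      using norm_le_l1_cart[of "gauss_vec \<omega>" for \<omega> :: "'n \<Rightarrow> real"] by (simp add: gauss_vec_def sum_nonneg)
  qed measurable
  with integrable_ln_pos_homogeneous[OF g gauss_vec_borel, of "axis i 1"] gauss_vec_ln[of "axis i 1 :: real ^ 'n"]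
  show "AE \<omega> in gauss. gauss_vec \<omega> \<noteq> (0 :: real ^ 'n)" "integrable gauss (\<lambda>\<omega>. ln (g (gauss_vec \<omega>)))"
    by (auto simp: gauss.finite_measure_axioms)
qed

lemma cauchy_vec_pos_homogeneous:
  fixes g :: "real ^ 'n \<Rightarrow> real"
  assumes g: "pos_homogeneous g" and r: "0 < r"
  shows "AE \<omega> in gauss. cauchy_vec x r \<omega> \<noteq> 0" "integrable gauss (\<lambda>\<omega>. ln (g (cauchy_vec x r \<omega>)))"
proof -
  obtain i :: 'n where True by simp
  have "integrable gauss (\<lambda>\<omega>. norm (cauchy_vec x r \<omega>))"
  proof (rule Bochner_Integration.integrable_bound)
    show "integrable gauss (\<lambda>\<omega>. \<bar>\<omega> None\<bar> * norm x + r * (\<Sum>i\<in>UNIV. \<bar>\<omega> (Some (i::'n))\<bar>))"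
      by (intro Bochner_Integration.integrable_add integrable_mult_left integrable_mult_right
          Bochner_Integration.integrable_sum gauss_integrable_component)
    have "norm (cauchy_vec x r \<omega>) \<le> \<bar>\<omega> None\<bar> * norm x + r * (\<Sum>i\<in>UNIV. \<bar>\<omega> (Some (i::'n))\<bar>)" for \<omega>
    proof -
      have "norm (\<chi> i. \<omega> (Some i) :: real ^ 'n) \<le> (\<Sum>i\<in>UNIV. \<bar>\<omega> (Some (i::'n))\<bar>)"
        using norm_le_l1_cart[of "\<chi> i. \<omega> (Some i) :: real ^ 'n"] by simp
      then have "norm (r *\<^sub>R (\<chi> i. \<omega> (Some i) :: real ^ 'n)) \<le> r * (\<Sum>i\<in>UNIV. \<bar>\<omega> (Some (i::'n))\<bar>)"
        using r by (simp add: mult_left_mono)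
      then show ?thesis unfolding cauchy_vec_def
        by (intro norm_triangle_le) simp
    qed
    moreover have "0 \<le> \<bar>\<omega> None\<bar> * norm x + r * (\<Sum>i\<in>UNIV. \<bar>\<omega> (Some (i::'n))\<bar>)" for \<omega>
      using r by (simp add: sum_nonneg)
    ultimately show "AE \<omega> in gauss. norm (norm (cauchy_vec x r \<omega>))
        \<le> norm (\<bar>\<omega> None\<bar> * norm x + r * (\<Sum>i\<in>UNIV. \<bar>\<omega> (Some (i::'n))\<bar>))"
      by simp
  qed measurable
  moreover have "(x \<bullet> axis i 1)\<^sup>2 + (r * norm (axis i (1::real)))\<^sup>2 \<noteq> 0"
    using r by (simp add: sum_power2_eq_zero_iff)
  ultimately
  show "AE \<omega> in gauss. cauchy_vec x r \<omega> \<noteq> 0" "integrable gauss (\<lambda>\<omega>. ln (g (cauchy_vec x r \<omega>)))"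
    using integrable_ln_pos_homogeneous[OF g cauchy_vec_borel, of x r "axis i 1"]
      cauchy_vec_ln[of x "axis i 1 :: real ^ 'n" r]
    by (auto simp: gauss.finite_measure_axioms)
qed

section \<open>Exchange of Gaussian averages for an ellipsoid norm\<close>

lemma smooth_ln_scale:
  assumes "0 < r" "0 < c"
  shows "smooth_ln (r * c) (c * t) = smooth_ln r t + ln c"
proof -
  have pos: "0 < t\<^sup>2 + r\<^sup>2" using assms by (simp add: add_nonneg_pos)
  have "(c * t)\<^sup>2 + (r * c)\<^sup>2 = c\<^sup>2 * (t\<^sup>2 + r\<^sup>2)" by (simp add: algebra_simps power_mult_distrib)
  then have "sqrt ((c * t)\<^sup>2 + (r * c)\<^sup>2) = c * sqrt (t\<^sup>2 + r\<^sup>2)"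
    using assms by (simp add: real_sqrt_mult)
  then show ?thesis using assms pos by (simp add: smooth_ln_def ln_mult)
qed

lemma abs_smooth_ln_le:
  assumes "0 < r" "\<bar>t\<bar> \<le> b"
  shows "\<bar>smooth_ln r t\<bar> \<le> \<bar>ln r\<bar> + \<bar>smooth_ln r b\<bar>"
proof -
  have "smooth_ln r 0 \<le> smooth_ln r t" unfolding smooth_ln_def
    using assms by (intro ln_mono) (auto simp: add_nonneg_pos)
  moreover have "smooth_ln r t \<le> smooth_ln r b" unfolding smooth_ln_def
  proof (intro ln_mono real_sqrt_le_mono add_right_mono)
    show "t\<^sup>2 \<le> b\<^sup>2" using assms by (simp add: abs_le_square_iff[symmetric])
  qed (use assms in \<open>auto simp: add_nonneg_pos\<close>)
  moreover have "smooth_ln r 0 = ln r" using assms by (simp add: smooth_ln_def)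
  ultimately show ?thesis by linarith
qed

text \<open>The value at \<open>0\<close> is some unit vector, so that laws of directions live on
  the sphere without an exceptional set.\<close>

definition direction :: "real ^ 'n \<Rightarrow> real ^ 'n" where
  "direction v = (if v = 0 then axis undefined 1 else sgn v)"

lemma norm_direction [simp]: "norm (direction v) = 1"
  by (simp add: direction_def norm_sgn)

lemma direction_borel [measurable]: "direction \<in> borel_measurable borel"
  unfolding direction_def[abs_def] sgn_div_norm by measurable

lemma linear_borel:
  fixes T :: "real ^ 'n \<Rightarrow> real ^ 'n"
  assumes "linear T"
  shows "T \<in> borel_measurable borel"
  using assms by (intro borel_measurable_continuous_onI linear_continuous_on) (simp add: linear_conv_bounded_linear)

lemma abs_smooth_ln_inner_le:
  assumes "0 < r" "norm u \<le> 1"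
  shows "\<bar>smooth_ln r (x \<bullet> u)\<bar> \<le> \<bar>ln r\<bar> + \<bar>smooth_ln r (norm x)\<bar>"
proof (rule abs_smooth_ln_le[OF assms(1)])
  have "\<bar>x \<bullet> u\<bar> \<le> norm x * norm u" by (rule Cauchy_Schwarz_ineq2)
  also have "\<dots> \<le> norm x" using assms(2) by (intro mult_left_le) auto
  finally show "\<bar>x \<bullet> u\<bar> \<le> norm x" .
qed

text \<open>With \<open>v\<close> the Cauchy vector and \<open>N'\<close> an independent Gaussian
  vector, average \<open>ln |(T v, N')| = ln |(v, T' N')|\<close> over both. Over \<open>N'\<close>
  first, this gives \<open>ln |T v|\<close> plus \<open>gauss_ln_mean\<close>; over \<open>v\<close>
  first, it gives the smoothed logarithm at \<open>T' N'\<close> plus the same constant, and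
  \<open>smooth_ln_scale\<close> splits off the length of \<open>T' N'\<close>. Fubini's theorem
  equates the results.\<close>

lemma cauchy_vec_ellipsoid:
  fixes T T' :: "real ^ 'n \<Rightarrow> real ^ 'n"
  assumes T: "linear T" "bij T" and T': "linear T'" "\<And>x y. T x \<bullet> y = x \<bullet> T' y"
    and r: "0 < r"
  shows "(\<integral>\<omega>. ln (norm (T (cauchy_vec x r \<omega>))) \<partial>gauss) =
    (\<integral>\<omega>. smooth_ln r (x \<bullet> direction (T' (gauss_vec \<omega>))) \<partial>gauss) + (\<integral>\<omega>. ln (norm (T' (gauss_vec \<omega>))) \<partial>gauss)"
    (is "?lhs = ?A + ?B")
proof -
  \<comment> \<open>The kernel of \<open>T'\<close> is orthogonal to the range of \<open>T\<close>,
    which is the whole space.\<close>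
  have "inj T'"
  proof (subst linear_injective_0[OF T'(1)], intro allI impI)
    fix y assume "T' y = 0"
    then have "T x \<bullet> y = 0" for x using T'(2)[of x y] by simp
    then have "z \<bullet> y = 0" for z using bij_is_surj[OF T(2)] by (metis surjD)
    then show "y = 0" using inner_eq_zero_iff by blast
  qed
  note [measurable] = linear_borel[OF T(1)] linear_borel[OF T'(1)]
  note hT = pos_homogeneous_norm_linear[OF T(1) bij_is_inj[OF T(2)]]
  note hT' = pos_homogeneous_norm_linear[OF T'(1) \<open>inj T'\<close>]
  have T0: "T v = 0 \<longleftrightarrow> v = 0" "T' v = 0 \<longleftrightarrow> v = 0" for v
    using pos_homogeneous_pos[OF hT, of v] pos_homogeneous_0[OF hT]
      pos_homogeneous_pos[OF hT', of v] pos_homogeneous_0[OF hT'] by (cases "v = 0"; simp)+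
  define f where "f \<omega>' \<omega> = ln \<bar>cauchy_vec x r \<omega> \<bullet> T' (gauss_vec \<omega>')\<bar>"
    for \<omega>' :: "'n \<Rightarrow> real" and \<omega> :: "'n option \<Rightarrow> real"
  define b where "b \<omega>' = smooth_ln r (x \<bullet> direction (T' (gauss_vec \<omega>'))) + ln (norm (T' (gauss_vec \<omega>')))" for \<omega>' :: "'n \<Rightarrow> real"
  have nz': "AE \<omega>' in gauss. T' (gauss_vec \<omega>') \<noteq> (0 :: real ^ 'n)"
    using gauss_vec_pos_homogeneous(1)[OF hT'] by (simp add: T0)
  have intB: "integrable gauss (\<lambda>\<omega>. ln (norm (T' (gauss_vec \<omega>))))"
    by (rule gauss_vec_pos_homogeneous(2)[OF hT'])
  have intA: "integrable gauss (\<lambda>\<omega>. smooth_ln r (x \<bullet> direction (T' (gauss_vec \<omega>))))"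
    by (rule gauss.integrable_const_bound[of _ "\<bar>ln r\<bar> + \<bar>smooth_ln r (norm x)\<bar>"])
      (auto intro!: AE_I2 abs_smooth_ln_inner_le[OF r])
  have intb: "integrable gauss b" unfolding b_def using intA intB by simp
  have fw: "integrable gauss (f \<omega>')" "(\<integral>\<omega>. f \<omega>' \<omega> \<partial>gauss) = b \<omega>' + gauss_ln_mean"
      "(\<integral>\<omega>. norm (f \<omega>' \<omega>) \<partial>gauss) \<le> \<bar>b \<omega>'\<bar> + gauss_abs_ln_mean" if "T' (gauss_vec \<omega>') \<noteq> 0" for \<omega>'
  proof -
    let ?y = "T' (gauss_vec \<omega>')"
    have pos: "0 < norm ?y" using that by simp
    have nz: "(x \<bullet> ?y)\<^sup>2 + (r * norm ?y)\<^sup>2 \<noteq> 0" using that r by (simp add: sum_power2_eq_zero_iff)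
    have "x \<bullet> ?y = norm ?y * (x \<bullet> direction ?y)" using that by (simp add: direction_def sgn_div_norm)
    then have b: "smooth_ln (r * norm ?y) (x \<bullet> ?y) = b \<omega>'"
      using smooth_ln_scale[OF r pos, of "x \<bullet> direction ?y"] by (simp add: b_def)
    show "integrable gauss (f \<omega>')" "(\<integral>\<omega>. f \<omega>' \<omega> \<partial>gauss) = b \<omega>' + gauss_ln_mean"
      "(\<integral>\<omega>. norm (f \<omega>' \<omega>) \<partial>gauss) \<le> \<bar>b \<omega>'\<bar> + gauss_abs_ln_mean"
      unfolding f_def b[symmetric] using cauchy_vec_ln[OF nz] by auto
  qed
  interpret P: pair_sigma_finite "gauss :: ('n \<Rightarrow> real) measure" "gauss :: ('n option \<Rightarrow> real) measure" ..
  have meas: "(\<lambda>(\<omega>', \<omega>). f \<omega>' \<omega>) \<in> borel_measurable (gauss \<Otimes>\<^sub>M gauss)"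
    unfolding f_def by measurable
  \<comment> \<open>The inner absolute integral is at most \<open>|b \<omega>'|\<close> plus a
    constant, and \<open>b\<close> is integrable: its direction part is bounded, its length part is
    the logarithm of a norm of a Gaussian vector.\<close>
  have "integrable (gauss \<Otimes>\<^sub>M gauss) (\<lambda>(\<omega>', \<omega>). f \<omega>' \<omega>)"
  proof (rule P.Fubini_integrable[OF meas])
    show "integrable gauss (\<lambda>\<omega>'. \<integral>\<omega>. norm (case (\<omega>', \<omega>) of (\<omega>', \<omega>) \<Rightarrow> f \<omega>' \<omega>) \<partial>gauss)"
    proof (rule Bochner_Integration.integrable_bound)
      show "integrable gauss (\<lambda>\<omega>'. \<bar>b \<omega>'\<bar> + gauss_abs_ln_mean)" using intb by simp
      show "AE \<omega>' in gauss. norm (\<integral>\<omega>. norm (case (\<omega>', \<omega>) of (\<omega>', \<omega>) \<Rightarrow> f \<omega>' \<omega>) \<partial>gauss) \<le> norm (\<bar>b \<omega>'\<bar> + gauss_abs_ln_mean)"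
        using nz'
      proof eventually_elim
        case (elim \<omega>')
        have "0 \<le> (\<integral>\<omega>. norm (f \<omega>' \<omega>) \<partial>gauss)" by simp
        with fw(3)[OF elim] show ?case by simp
      qed
      show "(\<lambda>\<omega>'. \<integral>\<omega>. norm (case (\<omega>', \<omega>) of (\<omega>', \<omega>) \<Rightarrow> f \<omega>' \<omega>) \<partial>gauss) \<in> borel_measurable gauss"
        using meas by measurable
    qed
    show "AE \<omega>' in gauss. integrable gauss (\<lambda>\<omega>. case (\<omega>', \<omega>) of (\<omega>', \<omega>) \<Rightarrow> f \<omega>' \<omega>)"
      using nz' by eventually_elim (use fw(1) in \<open>simp add: eta_contract_eq\<close>)
  qed
  from P.Fubini_integral[OF this]
  have fub: "(\<integral>\<omega>. (\<integral>\<omega>'. f \<omega>' \<omega> \<partial>gauss) \<partial>gauss) = (\<integral>\<omega>'. (\<integral>\<omega>. f \<omega>' \<omega> \<partial>gauss) \<partial>gauss)" by simp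
  have "(\<integral>\<omega>'. (\<integral>\<omega>. f \<omega>' \<omega> \<partial>gauss) \<partial>gauss) = (\<integral>\<omega>'. b \<omega>' + gauss_ln_mean \<partial>gauss)"
    by (rule integral_cong_AE) (use meas intb nz' fw(2) in \<open>auto elim!: eventually_mono\<close>)
  also have "\<dots> = ?A + ?B + gauss_ln_mean"
    using intA intB intb unfolding b_def by simp
  finally have R: "(\<integral>\<omega>'. (\<integral>\<omega>. f \<omega>' \<omega> \<partial>gauss) \<partial>gauss) = ?A + ?B + gauss_ln_mean" .
  have inner: "(\<integral>\<omega>'. f \<omega>' \<omega> \<partial>gauss) = ln (norm (T (cauchy_vec x r \<omega>))) + gauss_ln_mean" if "cauchy_vec x r \<omega> \<noteq> 0" for \<omega>
  proof -
    have "f \<omega>' \<omega> = ln \<bar>gauss_vec \<omega>' \<bullet> T (cauchy_vec x r \<omega>)\<bar>" for \<omega>'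
      unfolding f_def by (metis T'(2) inner_commute)
    then show ?thesis using gauss_vec_ln(3)[of "T (cauchy_vec x r \<omega>)"] that by (simp add: T0)
  qed
  have intL: "integrable gauss (\<lambda>\<omega>. ln (norm (T (cauchy_vec x r \<omega>))))"
    by (rule cauchy_vec_pos_homogeneous(2)[OF hT r])
  have "(\<integral>\<omega>. (\<integral>\<omega>'. f \<omega>' \<omega> \<partial>gauss) \<partial>gauss) = (\<integral>\<omega>. ln (norm (T (cauchy_vec x r \<omega>))) + gauss_ln_mean \<partial>gauss)"
    by (rule integral_cong_AE)
      (use meas intL cauchy_vec_pos_homogeneous(1)[OF hT r, of x] inner in \<open>auto elim!: eventually_mono\<close>)
  also have "\<dots> = ?lhs + gauss_ln_mean" using intL by simp
  finally show ?thesis using fub R by simp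
qed

section \<open>Limits of ellipsoid products\<close>

lemma integrable_smooth_ln_sphere:
  fixes \<nu> :: "(real ^ 'n) measure"
  assumes "finite_measure \<nu>" "sets \<nu> = sets borel" "AE \<xi> in \<nu>. \<xi> \<in> sphere 0 1" "0 < r"
  shows "integrable \<nu> (\<lambda>\<xi>. smooth_ln r (x \<bullet> \<xi>))"
proof -
  interpret finite_measure \<nu> by fact
  note [measurable_cong] = assms(2)
  show ?thesis
    by (rule integrable_const_bound[of _ "\<bar>ln r\<bar> + \<bar>smooth_ln r (norm x)\<bar>"])
      (use assms(3) in \<open>auto elim!: eventually_mono intro!: abs_smooth_ln_inner_le[OF assms(4)]\<close>)
qed

text \<open>\<open>\<mu>\<close> is the law of the direction of \<open>adjoint (T i) N'\<close> when
  \<open>i\<close> is drawn with probability \<open>w i\<close>. The lengths contribute only their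
  mean logarithms, which form \<open>\<kappa>\<close> and involve neither \<open>x\<close> nor
  \<open>r\<close>.\<close>

lemma ellipsoid_product_cauchy:
  fixes g :: "real ^ 'n \<Rightarrow> real"
  assumes "ellipsoid_product g" and hom: "pos_homogeneous g"
  obtains \<mu> :: "(real ^ 'n) measure" and \<kappa> where
    "prob_space \<mu>" "sets \<mu> = sets borel" "AE \<xi> in \<mu>. \<xi> \<in> sphere 0 1"
    "\<And>x r. 0 < r \<Longrightarrow> (\<integral>\<omega>. ln (g (cauchy_vec x r \<omega>)) \<partial>gauss) = (\<integral>\<xi>. smooth_ln r (x \<bullet> \<xi>) \<partial>\<mu>) + \<kappa>"
proof -
  obtain m :: nat and T :: "nat \<Rightarrow> real ^ 'n \<Rightarrow> real ^ 'n" and w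
    where T: "\<And>i. i \<in> {1..m} \<Longrightarrow> linear (T i) \<and> bij (T i) \<and> 0 < w i" and w: "sum w {1..m} = 1"
    and g: "\<And>x. x \<noteq> 0 \<Longrightarrow> ln (g x) = (\<Sum>i=1..m. w i * ln (norm (T i x)))"
    using ellipsoid_productE[OF assms(1)] by blast
  define W where "W = point_measure {1..m} w"
  have "emeasure W (space W) = (\<Sum>i=1..m. ennreal (w i))"
    unfolding W_def by (subst emeasure_point_measure_finite) (auto simp: space_point_measure)
  also have "\<dots> = 1" using T w by (subst sum_ennreal) (auto intro: less_imp_le)
  finally have pW: "prob_space W" by (rule prob_spaceI)
  interpret W: prob_space W by (rule pW)
  interpret P: pair_prob_space W "gauss :: ('n \<Rightarrow> real) measure" ..
  define u where "u = (\<lambda>(i, \<omega>). direction (adjoint (T i) (gauss_vec \<omega>)))"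
  have lin: "linear (adjoint (T i))" "T i y \<bullet> z = y \<bullet> adjoint (T i) z" if "i \<in> {1..m}" for i y z
    using T[OF that] by (metis adjoint_linear, metis adjoint_works)
  have um [measurable]: "u \<in> borel_measurable (W \<Otimes>\<^sub>M gauss)"
  proof -
    \<comment> \<open>The first factor is finite and discrete, so measurability in
      \<open>\<omega>\<close> for each fixed \<open>i\<close> suffices.\<close>
    have "u \<in> borel_measurable (count_space {1..m} \<Otimes>\<^sub>M gauss)"
    proof (rule measurable_pair_measure_countable1)
      fix i assume "i \<in> {1..m}"
      note [measurable] = linear_borel[OF lin(1)[OF this]]
      show "(\<lambda>\<omega>. u (i, \<omega>)) \<in> borel_measurable gauss" unfolding u_def by simp
    qed simp
    then show ?thesis
      by (subst measurable_cong_sets[OF sets_pair_measure_cong refl]) (auto simp: W_def sets_point_measure_count_space)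
  qed
  define \<mu> where "\<mu> = distr (W \<Otimes>\<^sub>M gauss) borel u"
  have norm_u: "norm (u z) = 1" for z unfolding u_def by (simp split: prod.split)
  have "AE \<xi> in \<mu>. \<xi> \<in> sphere 0 1"
    unfolding \<mu>_def by (subst AE_distr_iff[OF um]) (auto simp: norm_u)
  moreover have "prob_space \<mu>" unfolding \<mu>_def by (rule P.prob_space_distr[OF um])
  moreover have "sets \<mu> = sets borel" by (simp add: \<mu>_def)
  moreover have "(\<integral>\<omega>. ln (g (cauchy_vec x r \<omega>)) \<partial>gauss) = (\<integral>\<xi>. smooth_ln r (x \<bullet> \<xi>) \<partial>\<mu>) +
      (\<Sum>i=1..m. w i * (\<integral>\<omega>. ln (norm (adjoint (T i) (gauss_vec \<omega>))) \<partial>gauss))" if r: "0 < r" for x r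
  proof -
    let ?F = "\<lambda>i. \<integral>\<omega>. smooth_ln r (x \<bullet> direction (adjoint (T i) (gauss_vec \<omega>))) \<partial>gauss"
    have "integrable (W \<Otimes>\<^sub>M gauss) (\<lambda>z. smooth_ln r (x \<bullet> u z))"
      by (rule P.integrable_const_bound[of _ "\<bar>ln r\<bar> + \<bar>smooth_ln r (norm x)\<bar>"])
        (auto intro!: AE_I2 abs_smooth_ln_inner_le[OF r] simp: norm_u)
    from P.integral_fst'[OF this]
    have "(\<integral>\<xi>. smooth_ln r (x \<bullet> \<xi>) \<partial>\<mu>) = (\<integral>i. ?F i \<partial>W)"
      unfolding \<mu>_def by (subst integral_distr[OF um]) (auto simp: u_def)
    also have "\<dots> = (\<Sum>i=1..m. w i * ?F i)"
      unfolding W_def using T by (subst lebesgue_integral_point_measure_finite) (auto intro: less_imp_le)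
    finally have \<mu>: "(\<integral>\<xi>. smooth_ln r (x \<bullet> \<xi>) \<partial>\<mu>) = (\<Sum>i=1..m. w i * ?F i)" .
    have nz: "AE \<omega> in gauss. cauchy_vec x r \<omega> \<noteq> 0"
      by (rule cauchy_vec_pos_homogeneous(1)[OF pos_homogeneous_norm_linear[of id] r]) (auto intro: linear_id)
    have int: "integrable gauss (\<lambda>\<omega>. ln (norm (T i (cauchy_vec x r \<omega>))))" if "i \<in> {1..m}" for i
      using T[OF that] bij_is_inj
      by (intro cauchy_vec_pos_homogeneous(2)[OF pos_homogeneous_norm_linear r]) auto
    have "(\<integral>\<omega>. ln (g (cauchy_vec x r \<omega>)) \<partial>gauss) = (\<integral>\<omega>. (\<Sum>i=1..m. w i * ln (norm (T i (cauchy_vec x r \<omega>)))) \<partial>gauss)"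
    proof (rule integral_cong_AE)
      show "(\<lambda>\<omega>. ln (g (cauchy_vec x r \<omega>))) \<in> borel_measurable gauss"
        using cauchy_vec_pos_homogeneous(2)[OF hom r] by (rule borel_measurable_integrable)
      show "(\<lambda>\<omega>. \<Sum>i=1..m. w i * ln (norm (T i (cauchy_vec x r \<omega>)))) \<in> borel_measurable gauss"
        using int by (intro borel_measurable_sum borel_measurable_times) auto
    qed (use nz in \<open>eventually_elim, simp add: g\<close>)
    also have "\<dots> = (\<Sum>i=1..m. w i * (\<integral>\<omega>. ln (norm (T i (cauchy_vec x r \<omega>))) \<partial>gauss))"
      using int by (subst Bochner_Integration.integral_sum) auto
    also have "\<dots> = (\<Sum>i=1..m. w i * (?F i + (\<integral>\<omega>. ln (norm (adjoint (T i) (gauss_vec \<omega>))) \<partial>gauss)))"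
      using T lin r by (intro sum.cong refl) (subst cauchy_vec_ellipsoid[of _ "adjoint (T i)" for i], auto)
    finally show ?thesis unfolding \<mu> by (simp add: distrib_left sum.distrib)
  qed
  ultimately show ?thesis using that by blast
qed

section \<open>Vanishing smoothing radius\<close>

lemma gauss_component_nonzero: "AE \<omega> in gauss. \<omega> (i::'i::finite) \<noteq> 0"
proof -
  have "(\<Sum>j\<in>UNIV. (if j = i then 1 else 0) * \<omega> j) = \<omega> i" for \<omega> :: "'i \<Rightarrow> real"
    by (simp add: if_distrib[of "\<lambda>c. c * _"] cong: if_cong)
  moreover have "1 = sqrt (\<Sum>j\<in>UNIV. (if j = i then 1 else 0 :: real)\<^sup>2)"
    by (simp add: if_distrib[of "\<lambda>c. c\<^sup>2"] cong: if_cong)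
  ultimately show ?thesis using gauss_linear_nonzero[of 1 "\<lambda>j. if j = i then 1 else 0"] by simp
qed

text \<open>For the direction of a Gaussian vector the limiting kernel is
  \<open>ln |(N, x)| - ln |N|\<close>, whose two parts can be integrated separately. Combined with
  \<open>cauchy_vec_ellipsoid\<close> for the identity map, this settles the Euclidean norm.\<close>

lemma integral_smooth_ln_gauss_tendsto:
  fixes x :: "real ^ 'n"
  assumes x: "x \<noteq> 0" and r: "\<And>j. 0 < r j" "\<And>j. r j \<le> 1" "r \<longlonglongrightarrow> 0"
  shows "(\<lambda>j. \<integral>\<omega>. smooth_ln (r j) (x \<bullet> direction (gauss_vec \<omega>)) \<partial>gauss) \<longlonglongrightarrow>
    ln (norm x) + gauss_ln_mean - (\<integral>\<omega>. ln (norm (gauss_vec \<omega> :: real ^ 'n)) \<partial>gauss)"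
proof -
  have hom: "pos_homogeneous (\<lambda>v :: real ^ 'n. norm v)"
    using pos_homogeneous_norm_linear[of id] by (simp add: linear_id)
  note gv = gauss_vec_pos_homogeneous[OF hom]
  note gx = gauss_vec_ln[OF x]
  let ?l = "\<lambda>\<omega>. ln \<bar>gauss_vec \<omega> \<bullet> x\<bar> - ln (norm (gauss_vec \<omega> :: real ^ 'n))"
  have nz: "AE \<omega> in gauss. x \<bullet> direction (gauss_vec \<omega>) \<noteq> 0 \<and> ln \<bar>x \<bullet> direction (gauss_vec \<omega>)\<bar> = ?l \<omega>"
    using gv(1) gx(1)
  proof eventually_elim
    case (elim \<omega>)
    then have "x \<bullet> direction (gauss_vec \<omega>) = (gauss_vec \<omega> \<bullet> x) / norm (gauss_vec \<omega> :: real ^ 'n)"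
      by (simp add: direction_def sgn_div_norm inner_commute divide_inverse mult.commute)
    with elim show ?case by (simp add: ln_div)
  qed
  have l: "integrable gauss ?l" using gv(2) gx(2) by simp
  have "(\<lambda>j. \<integral>\<omega>. smooth_ln (r j) (x \<bullet> direction (gauss_vec \<omega>)) \<partial>gauss) \<longlonglongrightarrow> (\<integral>\<omega>. ?l \<omega> \<partial>gauss)"
  \<comment> \<open>For \<open>t \<noteq> 0\<close> and \<open>0 < r \<le> 1\<close> the kernel lies
    between \<open>ln |t|\<close> and \<open>smooth_ln 1 t\<close>; the limit itself dominates from
    below, a constant from above.\<close>
  proof (rule integral_dominated_convergence[where w="\<lambda>\<omega>. \<bar>?l \<omega>\<bar> + \<bar>smooth_ln 1 (norm x)\<bar>"])
    show "integrable gauss (\<lambda>\<omega>. \<bar>?l \<omega>\<bar> + \<bar>smooth_ln 1 (norm x)\<bar>)" using l by simp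
    show "AE \<omega> in gauss. (\<lambda>j. smooth_ln (r j) (x \<bullet> direction (gauss_vec \<omega>))) \<longlonglongrightarrow> ?l \<omega>"
      using nz by eventually_elim (use smooth_ln_tendsto[OF _ r(3)] in force)
    show "AE \<omega> in gauss. norm (smooth_ln (r j) (x \<bullet> direction (gauss_vec \<omega>))) \<le> \<bar>?l \<omega>\<bar> + \<bar>smooth_ln 1 (norm x)\<bar>" for j
      using nz
    proof eventually_elim
      case (elim \<omega>)
      have "ln \<bar>x \<bullet> direction (gauss_vec \<omega>)\<bar> \<le> smooth_ln (r j) (x \<bullet> direction (gauss_vec \<omega>))"
        using elim by (intro ln_le_smooth_ln) simp
      moreover have "smooth_ln (r j) (x \<bullet> direction (gauss_vec \<omega>)) \<le> smooth_ln 1 (x \<bullet> direction (gauss_vec \<omega>))"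
        using r by (intro smooth_ln_mono) auto
      moreover have "\<bar>smooth_ln 1 (x \<bullet> direction (gauss_vec \<omega>))\<bar> \<le> \<bar>smooth_ln 1 (norm x)\<bar>"
        using abs_smooth_ln_inner_le[of 1 "direction (gauss_vec \<omega>)" x] by simp
      ultimately show ?case using elim unfolding real_norm_def by linarith
    qed
  qed auto
  also have "(\<integral>\<omega>. ?l \<omega> \<partial>gauss) = ln (norm x) + gauss_ln_mean - (\<integral>\<omega>. ln (norm (gauss_vec \<omega> :: real ^ 'n)) \<partial>gauss)"
    using gv(2) gx(2,3) by simp
  finally show ?thesis .
qed

text \<open>Dominating \<open>ln g\<close> directly would require a bound uniform in
  \<open>r\<close> where the Cauchy vector is small. Subtracting the logarithm of the Euclidean norm
  leaves a bounded function of the direction, and the Euclidean part is already known.\<close>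

lemma cauchy_vec_tendsto:
  fixes g :: "real ^ 'n \<Rightarrow> real"
  assumes g: "pos_homogeneous g" and even: "\<And>x. g (- x) = g x"
    and x: "x \<noteq> 0" and r: "\<And>j. 0 < r j" "\<And>j. r j \<le> 1" "r \<longlonglongrightarrow> 0"
  shows "(\<lambda>j. \<integral>\<omega>. ln (g (cauchy_vec x (r j) \<omega>)) \<partial>gauss) \<longlonglongrightarrow> ln (g x) + gauss_ln_mean"
proof -
  have hom: "pos_homogeneous (\<lambda>v :: real ^ 'n. norm v)"
    using pos_homogeneous_norm_linear[of id] by (simp add: linear_id)
  obtain B where B: "0 \<le> B" "\<And>x. x \<noteq> 0 \<Longrightarrow> \<bar>ln (g x) - ln (norm x)\<bar> \<le> B"
    using pos_homogeneous_ln_bound[OF g] by blast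
  have [measurable]: "g \<in> borel_measurable borel" by (rule pos_homogeneous_borel[OF g])
  let ?v = "\<lambda>j \<omega>. cauchy_vec x (r j) \<omega>"
  have 1: "(\<lambda>j. \<integral>\<omega>. ln (norm (?v j \<omega>)) \<partial>gauss) \<longlonglongrightarrow> ln (norm x) + gauss_ln_mean"
  proof -
    have "(\<integral>\<omega>. ln (norm (?v j \<omega>)) \<partial>gauss) = (\<integral>\<omega>. smooth_ln (r j) (x \<bullet> direction (gauss_vec \<omega>)) \<partial>gauss)
        + (\<integral>\<omega>. ln (norm (gauss_vec \<omega> :: real ^ 'n)) \<partial>gauss)" for j
      using cauchy_vec_ellipsoid[of id id "r j" x] r(1)[of j] by (simp add: linear_id)
    then show ?thesis
      using tendsto_add[OF integral_smooth_ln_gauss_tendsto[OF x r] tendsto_const[of "\<integral>\<omega>. ln (norm (gauss_vec \<omega> :: real ^ 'n)) \<partial>gauss"]]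
      by simp
  qed
  have 2: "(\<lambda>j. \<integral>\<omega>. ln (g (?v j \<omega>)) - ln (norm (?v j \<omega>)) \<partial>gauss) \<longlonglongrightarrow>
      (\<integral>\<omega>. ln (g x) - ln (norm x) \<partial>(gauss :: ('n option \<Rightarrow> real) measure))"
  proof (rule integral_dominated_convergence[where w="\<lambda>_. B"])
    show "AE \<omega> in gauss. (\<lambda>j. ln (g (?v j \<omega>)) - ln (norm (?v j \<omega>))) \<longlonglongrightarrow> ln (g x) - ln (norm x)"
      using gauss_component_nonzero[of None]
    proof eventually_elim
      case (elim \<omega>)
      let ?y = "\<omega> None *\<^sub>R x"
      have y: "?y \<noteq> 0" using elim x by simp
      have "?v j \<omega> = ?y + r j *\<^sub>R (\<chi> i. \<omega> (Some i))" for j by (simp add: cauchy_vec_def)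
      moreover have "(\<lambda>j. ?y + r j *\<^sub>R (\<chi> i. \<omega> (Some i))) \<longlonglongrightarrow> ?y + 0 *\<^sub>R (\<chi> i. \<omega> (Some i))"
        by (intro tendsto_intros r(3))
      ultimately have v: "(\<lambda>j. ?v j \<omega>) \<longlonglongrightarrow> ?y" by simp
      \<comment> \<open>The limit vector is \<open>N\<^sub>0 x\<close> with \<open>N\<^sub>0\<close>
        of either sign, hence the evenness; the factor \<open>|N\<^sub>0|\<close> then cancels
        against the norm.\<close>
      have "g ?y = \<bar>\<omega> None\<bar> * g x"
        using pos_homogeneous_scale[OF g, of "\<bar>\<omega> None\<bar>" x] even[of ?y] by (cases "\<omega> None \<ge> 0") auto
      then have lim: "ln (g ?y) - ln (norm ?y) = ln (g x) - ln (norm x)"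
        using elim x pos_homogeneous_pos[OF g x] by (simp add: ln_mult)
      have "(\<lambda>j. ln (g (?v j \<omega>)) - ln (norm (?v j \<omega>))) \<longlonglongrightarrow> ln (g ?y) - ln (norm ?y)"
        using pos_homogeneous_pos[OF g y] y
        by (intro tendsto_intros v isCont_tendsto_compose[OF pos_homogeneous_isCont[OF g y]]) auto
      then show ?case unfolding lim .
    qed
    show "AE \<omega> in gauss. norm (ln (g (?v j \<omega>)) - ln (norm (?v j \<omega>))) \<le> B" for j
      using cauchy_vec_pos_homogeneous(1)[OF g r(1)[of j], of x] by eventually_elim (use B(2) in simp)
  qed auto
  have "(\<integral>\<omega>. ln (g (?v j \<omega>)) \<partial>gauss) =
      (\<integral>\<omega>. ln (g (?v j \<omega>)) - ln (norm (?v j \<omega>)) \<partial>gauss) + (\<integral>\<omega>. ln (norm (?v j \<omega>)) \<partial>gauss)" for j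
    using cauchy_vec_pos_homogeneous(2)[OF g r(1)] cauchy_vec_pos_homogeneous(2)[OF hom r(1)] by simp
  then show ?thesis using tendsto_add[OF 2 1] by simp
qed

text \<open>The kernels decrease with \<open>r\<close>, so monotone convergence applies once the
  hyperplane orthogonal to \<open>x\<close> is known to be null. It is: mass there would contribute
  that mass times \<open>ln (r j)\<close> and drive the integrals to
  \<open>- \<infinity>\<close>.\<close>

lemma smooth_potential_limit:
  fixes \<nu> :: "(real ^ 'n) measure"
  assumes fin: "finite_measure \<nu>" and sets: "sets \<nu> = sets borel" and supp: "AE \<xi> in \<nu>. \<xi> \<in> sphere 0 1"
    and r: "\<And>j. 0 < r j" "\<And>j. r j \<le> 1" "decseq r" "r \<longlonglongrightarrow> 0"
    and lim: "(\<lambda>j. \<integral>\<xi>. smooth_ln (r j) (x \<bullet> \<xi>) \<partial>\<nu>) \<longlonglongrightarrow> l"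
  shows "AE \<xi> in \<nu>. x \<bullet> \<xi> \<noteq> 0" "integrable \<nu> (\<lambda>\<xi>. ln \<bar>x \<bullet> \<xi>\<bar>)" "(\<integral>\<xi>. ln \<bar>x \<bullet> \<xi>\<bar> \<partial>\<nu>) = l"
proof -
  interpret finite_measure \<nu> by (rule fin)
  note [measurable_cong] = sets
  note int = integrable_smooth_ln_sphere[OF fin sets supp r(1)]
  define A where "A = {\<xi> \<in> space \<nu>. x \<bullet> \<xi> = 0}"
  have [measurable]: "A \<in> sets \<nu>" unfolding A_def by measurable
  define b where "b = \<bar>smooth_ln 1 (norm x)\<bar>"
  have "measure \<nu> A = 0"
  proof (rule ccontr)
    assume "measure \<nu> A \<noteq> 0"
    then have A: "0 < measure \<nu> A" by (simp add: zero_less_measure_iff)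
    have le: "(\<integral>\<xi>. smooth_ln (r j) (x \<bullet> \<xi>) \<partial>\<nu>) \<le> measure \<nu> A * ln (r j) + b * measure \<nu> (space \<nu>)" for j
    proof -
      have "(\<integral>\<xi>. smooth_ln (r j) (x \<bullet> \<xi>) \<partial>\<nu>) \<le> (\<integral>\<xi>. indicator A \<xi> * ln (r j) + b \<partial>\<nu>)"
      proof (rule integral_mono_AE[OF int])
        show "AE \<xi> in \<nu>. smooth_ln (r j) (x \<bullet> \<xi>) \<le> indicator A \<xi> * ln (r j) + b"
          using supp AE_space
        proof eventually_elim
          case (elim \<xi>)
          have "smooth_ln (r j) 0 = ln (r j)" using r(1)[of j] by (simp add: smooth_ln_def)
          moreover have "smooth_ln (r j) (x \<bullet> \<xi>) \<le> smooth_ln 1 (x \<bullet> \<xi>)"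
            using r by (intro smooth_ln_mono) auto
          moreover have "\<bar>smooth_ln 1 (x \<bullet> \<xi>)\<bar> \<le> b"
            using abs_smooth_ln_inner_le[of 1 \<xi> x] elim by (simp add: b_def)
          moreover have "0 \<le> b" by (simp add: b_def)
          ultimately show ?case using elim by (auto simp: A_def indicator_def)
        qed
        show "integrable \<nu> (\<lambda>\<xi>. indicator A \<xi> * ln (r j) + b)"
          by (intro Bochner_Integration.integrable_add integrable_mult_left) (auto simp: less_top[symmetric])
      qed
      also have "\<dots> = measure \<nu> A * ln (r j) + b * measure \<nu> (space \<nu>)"
        by (subst Bochner_Integration.integral_add) (auto simp: less_top[symmetric] mult.commute)
      finally show ?thesis .
    qed
    obtain D where D: "\<And>j. D \<le> (\<integral>\<xi>. smooth_ln (r j) (x \<bullet> \<xi>) \<partial>\<nu>)"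
    proof -
      have "Bseq (\<lambda>j. \<integral>\<xi>. smooth_ln (r j) (x \<bullet> \<xi>) \<partial>\<nu>)"
        using lim convergentI convergent_imp_Bseq by blast
      then obtain D where "\<And>j. norm (\<integral>\<xi>. smooth_ln (r j) (x \<bullet> \<xi>) \<partial>\<nu>) \<le> D"
        by (auto simp: Bseq_def)
      then have "- D \<le> (\<integral>\<xi>. smooth_ln (r j) (x \<bullet> \<xi>) \<partial>\<nu>)" for j
        by (metis abs_le_D2 minus_le_iff real_norm_def)
      then show ?thesis using that by blast
    qed
    \<comment> \<open>The upper bound \<open>le\<close> and the lower bound \<open>D\<close>, solved
      for \<open>r j\<close>: a positive constant below a sequence tending to
      \<open>0\<close>.\<close>
    define c where "c = exp ((D - b * measure \<nu> (space \<nu>)) / measure \<nu> A)"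
    have "c \<le> r j" for j
    proof -
      have "(D - b * measure \<nu> (space \<nu>)) / measure \<nu> A \<le> ln (r j)"
        using A le[of j] D[of j] by (simp add: field_simps)
      then show ?thesis unfolding c_def using r(1)[of j] by (metis exp_le_cancel_iff exp_ln)
    qed
    then have "c \<le> 0" by (intro LIMSEQ_le_const[OF r(4)]) blast
    then show False unfolding c_def using exp_gt_zero not_le by blast
  qed
  then have "A \<in> null_sets \<nu>" by (auto simp: null_sets_def emeasure_eq_measure)
  from AE_not_in[OF this] AE_space[of \<nu>] show ae: "AE \<xi> in \<nu>. x \<bullet> \<xi> \<noteq> 0"
    by eventually_elim (simp add: A_def)
  have lim': "AE \<xi> in \<nu>. (\<lambda>j. - smooth_ln (r j) (x \<bullet> \<xi>)) \<longlonglongrightarrow> - ln \<bar>x \<bullet> \<xi>\<bar>"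
    using ae by eventually_elim (intro tendsto_minus smooth_ln_tendsto r(4))
  have mono: "AE \<xi> in \<nu>. mono (\<lambda>j. - smooth_ln (r j) (x \<bullet> \<xi>))"
    by (rule AE_I2) (use r(1,3) in \<open>auto simp: mono_def decseq_def intro!: smooth_ln_mono\<close>)
  have ilim: "(\<lambda>j. \<integral>\<xi>. - smooth_ln (r j) (x \<bullet> \<xi>) \<partial>\<nu>) \<longlonglongrightarrow> - l"
    using tendsto_minus[OF lim] by simp
  have int': "integrable \<nu> (\<lambda>\<xi>. - smooth_ln (r j) (x \<bullet> \<xi>))" for j using int by simp
  have m: "(\<lambda>\<xi>. - ln \<bar>x \<bullet> \<xi>\<bar>) \<in> borel_measurable \<nu>" by measurable
  have "integrable \<nu> (\<lambda>\<xi>. - ln \<bar>x \<bullet> \<xi>\<bar>)" "(\<integral>\<xi>. - ln \<bar>x \<bullet> \<xi>\<bar> \<partial>\<nu>) = - l"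
    using integrable_monotone_convergence[OF int' mono lim' ilim m]
      integral_monotone_convergence[OF int' mono lim' ilim m] by auto
  then show "integrable \<nu> (\<lambda>\<xi>. ln \<bar>x \<bullet> \<xi>\<bar>)" "(\<integral>\<xi>. ln \<bar>x \<bullet> \<xi>\<bar> \<partial>\<nu>) = l" by auto
qed


text \<open>\<open>embeds_in_L0\<close> wants a measure on the sphere as a space of its own, whereas
  weak limits are taken in the whole space; restricting \<open>\<nu>\<close> loses no mass.\<close>

lemma embeds_in_L0I:
  fixes K :: "(real ^ 'n) set" and \<nu> :: "(real ^ 'n) measure"
  assumes K: "star_body K" and prob: "prob_space \<nu>" and sets: "sets \<nu> = sets borel"
    and supp: "AE \<xi> in \<nu>. \<xi> \<in> sphere 0 1"
    and nz: "\<And>x. x \<noteq> 0 \<Longrightarrow> AE \<xi> in \<nu>. x \<bullet> \<xi> \<noteq> 0"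
    and int: "\<And>x. x \<noteq> 0 \<Longrightarrow> integrable \<nu> (\<lambda>\<xi>. ln \<bar>x \<bullet> \<xi>\<bar>)"
    and eq: "\<And>x. x \<noteq> 0 \<Longrightarrow> ln (minkowski K x) = (\<integral>\<xi>. ln \<bar>x \<bullet> \<xi>\<bar> \<partial>\<nu>) + C"
  shows "embeds_in_L0 K"
proof -
  interpret prob_space \<nu> by (rule prob)
  note [measurable_cong] = sets
  note hom = pos_homogeneous_minkowski[OF K]
  define M where "M = restrict_space \<nu> (sphere 0 1)"
  have S [simp]: "sphere 0 1 \<inter> space \<nu> \<in> sets \<nu>"
    using sets sets_eq_imp_space_eq[OF sets] by simp
  have mass: "emeasure M (space M) = 1"
  proof -
    have "emeasure M (space M) = emeasure \<nu> (sphere 0 1 \<inter> space \<nu>)"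
      unfolding M_def by (subst emeasure_restrict_space) (auto simp: space_restrict_space Int_commute)
    also have "\<dots> = emeasure \<nu> (space \<nu>)"
      by (rule emeasure_eq_AE) (use supp in auto)
    finally show ?thesis by (simp add: emeasure_space_1)
  qed
  show ?thesis unfolding embeds_in_L0_def
  proof (intro exI conjI allI)
    show "finite_measure M" by (rule finite_measureI) (simp add: mass)
    show "sets M = sets (restrict_space borel (sphere 0 1))"
      unfolding M_def by (rule sets_restrict_space_cong[OF sets])
    fix x :: "real ^ 'n"
    show "ext_ln (minkowski K x) = ext_integral M (\<lambda>\<xi>. ext_ln \<bar>x \<bullet> \<xi>\<bar>) + ereal C"
    proof (cases "x = 0")
      case True
      \<comment> \<open>At \<open>x = 0\<close> the integrand is \<open>- \<infinity>\<close>
        throughout and the mass is positive, which matches \<open>ext_ln 0\<close>.\<close>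
      have "ext_integral M (\<lambda>\<xi>. ext_ln \<bar>x \<bullet> \<xi>\<bar>) = - \<infinity>"
        using True mass by (simp add: ext_integral_def ext_ln_def e2ennreal_infty e2ennreal_neg zero_ennreal.rep_eq)
      then show ?thesis using True pos_homogeneous_0[OF hom] by (simp add: ext_ln_def)
    next
      case False
      have h: "(\<lambda>\<xi>. \<bar>x \<bullet> \<xi>\<bar>) \<in> borel_measurable M"
        unfolding M_def by (rule measurable_restrict_space1) measurable
      have ae: "AE \<xi> in \<nu>. indicator (sphere 0 1) \<xi> *\<^sub>R ln \<bar>x \<bullet> \<xi>\<bar> = ln \<bar>x \<bullet> \<xi>\<bar>"
        using supp by eventually_elim simp
      have m: "(\<lambda>\<xi>. indicator (sphere 0 1) \<xi> *\<^sub>R ln \<bar>x \<bullet> \<xi>\<bar>) \<in> borel_measurable \<nu>"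
        by (intro borel_measurable_scaleR borel_measurable_indicator borel_measurable_integrable int[OF False])
          (simp add: sets)
      have "AE \<xi> in M. \<bar>x \<bullet> \<xi>\<bar> \<noteq> 0"
        unfolding M_def AE_restrict_space_iff[OF S] using nz[OF False] by auto
      moreover have "integrable M (\<lambda>\<xi>. ln \<bar>x \<bullet> \<xi>\<bar>)"
        unfolding M_def integrable_restrict_space[OF S]
        using int[OF False] by (rule integrable_cong_AE_imp[OF _ m]) (use ae in auto)
      moreover have "(\<integral>\<xi>. ln \<bar>x \<bullet> \<xi>\<bar> \<partial>M) = ln (minkowski K x) - C"
        unfolding M_def integral_restrict_space[OF S]
        using eq[OF False] integral_cong_AE[OF m borel_measurable_integrable[OF int[OF False]] ae] by simp
      ultimately have "ext_integral M (\<lambda>\<xi>. ext_ln \<bar>x \<bullet> \<xi>\<bar>) = ereal (ln (minkowski K x) - C)"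
        using ext_integral_ext_ln[OF h] by blast
      then show ?thesis using pos_homogeneous_pos[OF hom False] by (simp add: ext_ln_def)
    qed
  qed
qed

section \<open>From the radial metric to logarithms of norms\<close>

lemma radial_diff_le_radial_dist:
  assumes "star_body L" "star_body K" "norm x = 1"
  shows "\<bar>radial L x - radial K x\<bar> \<le> radial_dist L K"
  unfolding radial_dist_def
proof (rule cSUP_upper)
  have "continuous_on (sphere 0 1) (\<lambda>x. \<bar>radial L x - radial K x\<bar>)"
    using assms by (intro continuous_intros) (auto simp: star_body_def)
  then have "compact ((\<lambda>x. \<bar>radial L x - radial K x\<bar>) ` sphere 0 1)"
    by (rule compact_continuous_image[OF _ compact_sphere])
  then show "bdd_above ((\<lambda>x. \<bar>radial L x - radial K x\<bar>) ` sphere 0 1)"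
    by (intro bounded_imp_bdd_above compact_imp_bounded)
qed (use assms in auto)

text \<open>\<open>radial K\<close> is at least \<open>1 / M\<close> on the sphere, so a body within
  \<open>1 / (2 * M)\<close> has radial function at least \<open>1 / (2 * M)\<close>, and above that
  value \<open>ln\<close> has Lipschitz constant \<open>2 * M\<close>. The difference depends only
  on the direction, hence the bound at every \<open>x \<noteq> 0\<close>.\<close>

lemma ln_minkowski_diff_le:
  fixes K L :: "(real ^ 'n) set"
  assumes L: "star_body L" and K: "star_body K" and M: "0 < M" "\<And>u. norm u = 1 \<Longrightarrow> minkowski K u \<le> M"
    and d: "radial_dist L K \<le> 1 / (2 * M)" and x: "x \<noteq> 0"
  shows "\<bar>ln (minkowski L x) - ln (minkowski K x)\<bar> \<le> 2 * M * radial_dist L K"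
proof -
  note hL = pos_homogeneous_minkowski[OF L] and hK = pos_homogeneous_minkowski[OF K]
  define u where "u = sgn x"
  have u: "norm u = 1" "u \<noteq> 0" using x by (auto simp: u_def norm_sgn sgn_zero_iff)
  note gL = pos_homogeneous_pos[OF hL u(2)] and gK = pos_homogeneous_pos[OF hK u(2)]
  have "1 / M \<le> radial K u"
    using M(2)[OF u(1)] gK M(1) by (simp add: radial_def field_simps)
  moreover have diff: "\<bar>radial L u - radial K u\<bar> \<le> radial_dist L K"
    by (rule radial_diff_le_radial_dist[OF L K u(1)])
  moreover have "1 / M = 1 / (2 * M) + 1 / (2 * M)" "0 < 1 / (2 * M)" using M(1) by (auto simp: field_simps)
  ultimately have "1 / (2 * M) \<le> radial L u" "1 / (2 * M) \<le> radial K u" "0 < 1 / (2 * M)"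
    using d by linarith+
  then have "\<bar>ln (radial L u) - ln (radial K u)\<bar> \<le> \<bar>radial L u - radial K u\<bar> / (1 / (2 * M))"
    by (intro abs_ln_diff_le)
  also have "\<dots> \<le> radial_dist L K / (1 / (2 * M))"
    using diff M(1) by (intro divide_right_mono) auto
  finally have "\<bar>ln (radial L u) - ln (radial K u)\<bar> \<le> 2 * M * radial_dist L K" by (simp add: mult_ac)
  moreover have "ln (radial L u) = - ln (minkowski L u)" "ln (radial K u) = - ln (minkowski K u)"
    using gL gK by (auto simp: radial_def ln_inverse)
  ultimately show ?thesis
    using pos_homogeneous_ln[OF hL x] pos_homogeneous_ln[OF hK x] by (simp add: u_def abs_minus_commute)
qed

theorem embeds_in_L0_limit:
  fixes K :: "(real ^ 'n) set"
  assumes K: "star_body K" and L: "\<And>k. star_body (L k)" and prod: "\<And>k. ellipsoid_product (minkowski (L k))"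
    and lim: "(\<lambda>k. radial_dist (L k) K) \<longlonglongrightarrow> 0"
  shows "embeds_in_L0 K"
proof -
  note hK = pos_homogeneous_minkowski[OF K] and hL = pos_homogeneous_minkowski[OF L]
  let ?F = "\<lambda>A x r. \<integral>\<omega>. ln (minkowski A (cauchy_vec x r \<omega>)) \<partial>gauss"
  obtain M where M: "0 < M" "\<And>u. norm u = 1 \<Longrightarrow> minkowski K u \<le> M"
    using pos_homogeneous_bounds[OF hK] by (metis less_le_trans zero_less_one)
  have "\<forall>\<^sub>F k in sequentially. radial_dist (L k) K < 1 / (2 * M)"
    using order_tendstoD(2)[OF lim, of "1 / (2 * M)"] M(1) by simp
  then have close: "\<forall>\<^sub>F k in sequentially. \<forall>x. x \<noteq> 0 \<longrightarrow>
      \<bar>ln (minkowski (L k) x) - ln (minkowski K x)\<bar> \<le> 2 * M * radial_dist (L k) K"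
    by eventually_elim (use ln_minkowski_diff_le[OF L K M] in auto)
  have Flim: "(\<lambda>k. ?F (L k) x r) \<longlonglongrightarrow> ?F K x r" if r: "0 < r" for x r
  proof -
    note i = cauchy_vec_pos_homogeneous(2)[OF hL r, of _ x] cauchy_vec_pos_homogeneous(2)[OF hK r, of x]
    note nz = cauchy_vec_pos_homogeneous(1)[OF hK r, of x]
    have "\<forall>\<^sub>F k in sequentially. norm (?F (L k) x r - ?F K x r) \<le> 2 * M * radial_dist (L k) K"
      using close
    proof eventually_elim
      case (elim k)
      let ?d = "\<lambda>\<omega>. ln (minkowski (L k) (cauchy_vec x r \<omega>)) - ln (minkowski K (cauchy_vec x r \<omega>))"
      have "?F (L k) x r - ?F K x r = (\<integral>\<omega>. ?d \<omega> \<partial>gauss)" using i by simp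
      also have "norm \<dots> \<le> (\<integral>\<omega>. norm (?d \<omega>) \<partial>gauss)" by (rule integral_norm_bound)
      also have "\<dots> \<le> (\<integral>\<omega>. 2 * M * radial_dist (L k) K \<partial>(gauss :: ('n option \<Rightarrow> real) measure))"
      proof (rule integral_mono_AE)
        show "AE \<omega> in gauss. norm (?d \<omega>) \<le> 2 * M * radial_dist (L k) K"
          using nz by eventually_elim (use elim in simp)
      qed (use i in auto)
      finally show ?case by simp
    qed
    moreover have "(\<lambda>k. 2 * M * radial_dist (L k) K) \<longlonglongrightarrow> 0"
      using tendsto_mult_left[OF lim, of "2 * M"] by simp
    ultimately have "(\<lambda>k. ?F (L k) x r - ?F K x r) \<longlonglongrightarrow> 0" by (rule Lim_null_comparison)
    then show ?thesis by (rule LIM_zero_cancel)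
  qed
  define Q where "Q k \<mu> \<kappa> \<longleftrightarrow> prob_space \<mu> \<and> sets \<mu> = sets borel \<and> (AE \<xi> in \<mu>. \<xi> \<in> sphere 0 1) \<and>
      (\<forall>x r. 0 < r \<longrightarrow> ?F (L k) x r = (\<integral>\<xi>. smooth_ln r (x \<bullet> \<xi>) \<partial>\<mu>) + \<kappa>)"
    for k and \<mu> :: "(real ^ 'n) measure" and \<kappa> :: real
  have "\<exists>\<mu> \<kappa>. Q k \<mu> \<kappa>" for k
    by (rule ellipsoid_product_cauchy[OF prod[of k] hL]) (auto simp: Q_def)
  then obtain \<mu> \<kappa> where "\<And>k. Q k (\<mu> k) (\<kappa> k)" by metis
  then have \<mu>: "\<And>k. prob_space (\<mu> k)" "\<And>k. sets (\<mu> k) = sets borel" "\<And>k. AE \<xi> in \<mu> k. \<xi> \<in> sphere 0 1"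
    and F: "\<And>k x r. 0 < r \<Longrightarrow> ?F (L k) x r = (\<integral>\<xi>. smooth_ln r (x \<bullet> \<xi>) \<partial>\<mu> k) + \<kappa> k"
    unfolding Q_def by blast+
  have ne: "sphere (0 :: real ^ 'n) 1 \<noteq> {}" by simp
  obtain s \<nu> where s: "strict_mono s" and \<nu>: "prob_space \<nu>" "sets \<nu> = sets borel" "AE \<xi> in \<nu>. \<xi> \<in> sphere 0 1"
    and weak: "\<And>h :: real ^ 'n \<Rightarrow> real. continuous_on UNIV h \<Longrightarrow> (\<lambda>k. \<integral>\<xi>. h \<xi> \<partial>\<mu> (s k)) \<longlonglongrightarrow> (\<integral>\<xi>. h \<xi> \<partial>\<nu>)"
    by (rule prob_measures_weakly_compact[OF compact_sphere ne \<mu>]) (rule that)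
  \<comment> \<open>\<open>smooth_ln 1 0 = ln 1 = 0\<close>, so this value isolates the constant,
    and its convergence is an instance of \<open>Flim\<close>.\<close>
  have "?F (L k) 0 1 = \<kappa> k" for k using F[of 1 k 0] by (simp add: smooth_ln_def)
  then have \<kappa>: "\<kappa> \<longlonglongrightarrow> ?F K 0 1" using Flim[of 1 0] by simp
  have FK: "?F K x r = (\<integral>\<xi>. smooth_ln r (x \<bullet> \<xi>) \<partial>\<nu>) + ?F K 0 1" if r: "0 < r" for x r
  proof (rule LIMSEQ_unique)
    show "(\<lambda>k. ?F (L (s k)) x r) \<longlonglongrightarrow> ?F K x r"
      using LIMSEQ_subseq_LIMSEQ[OF Flim[OF r, of x] s] by (simp add: comp_def)
    have "(\<lambda>k. (\<integral>\<xi>. smooth_ln r (x \<bullet> \<xi>) \<partial>\<mu> (s k)) + \<kappa> (s k)) \<longlonglongrightarrow> (\<integral>\<xi>. smooth_ln r (x \<bullet> \<xi>) \<partial>\<nu>) + ?F K 0 1"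
      using LIMSEQ_subseq_LIMSEQ[OF \<kappa> s]
      by (intro tendsto_add weak continuous_intros r) (auto simp: comp_def)
    then show "(\<lambda>k. ?F (L (s k)) x r) \<longlonglongrightarrow> (\<integral>\<xi>. smooth_ln r (x \<bullet> \<xi>) \<partial>\<nu>) + ?F K 0 1"
      by (simp only: F[OF r])
  qed
  define r where "r j = inverse (real (Suc j))" for j
  have r: "\<And>j. 0 < r j" "\<And>j. r j \<le> 1" "decseq r" "r \<longlonglongrightarrow> 0"
    using LIMSEQ_inverse_real_of_nat by (auto simp: decseq_def field_simps r_def[abs_def])
  note fin = prob_space.finite_measure[OF \<nu>(1)]
  have pot: "(\<lambda>j. \<integral>\<xi>. smooth_ln (r j) (x \<bullet> \<xi>) \<partial>\<nu>) \<longlonglongrightarrow> ln (minkowski K x) + gauss_ln_mean - ?F K 0 1"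
    if x: "x \<noteq> 0" for x
  proof -
    have "(\<lambda>j. ?F K x (r j) - ?F K 0 1) \<longlonglongrightarrow> ln (minkowski K x) + gauss_ln_mean - ?F K 0 1"
      by (intro tendsto_diff tendsto_const cauchy_vec_tendsto[OF hK minkowski_minus[OF K] x r(1,2,4)])
    then show ?thesis using FK[OF r(1), of x] by simp
  qed
  \<comment> \<open>\<open>?F K 0 1\<close> is the limit of the constants \<open>\<kappa> k\<close>;
    \<open>gauss_ln_mean\<close> is what the factor \<open>N\<^sub>0\<close> leaves behind as the
    radius tends to \<open>0\<close>.\<close>
  show ?thesis
    by (rule embeds_in_L0I[OF K \<nu>, where C = "?F K 0 1 - gauss_ln_mean"])
      (use smooth_potential_limit[OF fin \<nu>(2,3) r pot] in auto)
qed

section \<open>Approximation by ellipsoid products\<close>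

text \<open>Points violating the bound accumulate at some \<open>x\<close>. By monotonicity a
  violation at a late index is one at every earlier \<open>j\<close>, so the limit along the points,
  followed by the limit in \<open>j\<close>, is contradictory.\<close>

lemma dini_decreasing:
  fixes f :: "nat \<Rightarrow> 'a::metric_space \<Rightarrow> real"
  assumes S: "compact S" and cont: "\<And>j. continuous_on S (f j)" "continuous_on S l"
    and mono: "\<And>x. x \<in> S \<Longrightarrow> decseq (\<lambda>j. f j x)" and lim: "\<And>x. x \<in> S \<Longrightarrow> (\<lambda>j. f j x) \<longlonglongrightarrow> l x"
    and e: "0 < e"
  shows "\<exists>j. \<forall>x\<in>S. f j x < l x + e"
proof (rule ccontr)
  assume "\<not> ?thesis"
  then have "\<forall>j. \<exists>x\<in>S. l x + e \<le> f j x" by (simp add: not_less)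
  then obtain y where y: "\<And>j. y j \<in> S" "\<And>j. l (y j) + e \<le> f j (y j)" by metis
  obtain x s where x: "x \<in> S" and s: "strict_mono s" and ys: "(y \<circ> s) \<longlonglongrightarrow> x"
    using S y(1) by (metis compact_def)
  have seq: "(\<lambda>k. h (y (s k))) \<longlonglongrightarrow> h x" if "continuous_on S h" for h :: "'a \<Rightarrow> real"
    using continuous_on_tendsto_compose[OF that ys x] y(1) by (simp add: comp_def)
  have "l x + e \<le> f j x" for j
  proof (rule LIMSEQ_le)
    show "(\<lambda>k. l (y (s k)) + e) \<longlonglongrightarrow> l x + e" by (intro tendsto_intros seq cont)
    show "(\<lambda>k. f j (y (s k))) \<longlonglongrightarrow> f j x" by (intro seq cont)
    show "\<exists>N. \<forall>k\<ge>N. l (y (s k)) + e \<le> f j (y (s k))"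
    proof (intro exI allI impI)
      fix k assume "j \<le> k"
      then have "j \<le> s k" using seq_suble[OF s, of k] by linarith
      then have "f (s k) (y (s k)) \<le> f j (y (s k))" using mono[OF y(1)] by (auto simp: decseq_def)
      then show "l (y (s k)) + e \<le> f j (y (s k))" using y(2)[of "s k"] by linarith
    qed
  qed
  then have "l x + e \<le> l x" by (intro LIMSEQ_le_const[OF lim[OF x]]) auto
  then show False using e by simp
qed

text \<open>On unit vectors \<open>exp (2 * smooth_ln r (x \<bullet> z))\<close> is the positive
  definite quadratic form with matrix \<open>r\<^sup>2 I + z z\<^sup>T\<close>. \<open>T\<close> is
  \<open>exp C\<close> times its square root, sought in the form \<open>r I + a z z\<^sup>T\<close>.
  The vector \<open>z\<close> need not be a unit vector.\<close>

lemma norm_linear_smooth_ln: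
  fixes z :: "real ^ 'n"
  assumes r: "0 < r"
  obtains T :: "real ^ 'n \<Rightarrow> real ^ 'n" where "linear T" "bij T"
    "\<And>x. norm x = 1 \<Longrightarrow> ln (norm (T x)) = C + smooth_ln r (x \<bullet> z)"
proof -
  define q where "q = sqrt (r\<^sup>2 + z \<bullet> z)"
  \<comment> \<open>Squaring \<open>r I + a z z\<^sup>T\<close> requires
    \<open>2 * r * a + a\<^sup>2 * (z \<bullet> z) = 1\<close>. Its positive root
    \<open>(q - r) / (z \<bullet> z)\<close> is written without the denominator that vanishes at
    \<open>z = 0\<close>.\<close>
  define a where "a = 1 / (r + q)"
  have q: "0 \<le> q" "q\<^sup>2 = r\<^sup>2 + z \<bullet> z" by (simp_all add: q_def)
  have a: "(r + q) * a = 1" using r q by (simp add: a_def)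
  have key: "2 * r * a + a\<^sup>2 * (z \<bullet> z) = 1"
  proof -
    have zz: "z \<bullet> z = (q - r) * (q + r)" using q(2) by (simp add: power2_eq_square algebra_simps)
    have "2 * r * a + a\<^sup>2 * (z \<bullet> z) = 2 * r * a + a * (q - r) * ((r + q) * a)"
      unfolding zz by (simp add: power2_eq_square algebra_simps)
    also have "\<dots> = 2 * r * a + a * (q - r)" using a by simp
    also have "\<dots> = (r + q) * a" by (simp add: algebra_simps)
    finally show ?thesis using a by simp
  qed
  define T where "T x = exp C *\<^sub>R (r *\<^sub>R x + (a * (x \<bullet> z)) *\<^sub>R z)" for x
  have lin: "linear T" unfolding T_def
    by (rule linearI) (auto simp: algebra_simps inner_add_left)
  have nT: "norm (T x) = exp C * sqrt ((x \<bullet> z)\<^sup>2 + (r * norm x)\<^sup>2)" for x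
  proof -
    have "(norm (r *\<^sub>R x + (a * (x \<bullet> z)) *\<^sub>R z))\<^sup>2 =
        (r * norm x)\<^sup>2 + (2 * r * a + a\<^sup>2 * (z \<bullet> z)) * (x \<bullet> z)\<^sup>2"
      unfolding power2_norm_eq_inner power_mult_distrib
      by (simp add: inner_add_left inner_add_right inner_commute power2_eq_square algebra_simps)
    then have "(norm (r *\<^sub>R x + (a * (x \<bullet> z)) *\<^sub>R z))\<^sup>2 = (x \<bullet> z)\<^sup>2 + (r * norm x)\<^sup>2"
      by (simp add: key)
    then have "norm (r *\<^sub>R x + (a * (x \<bullet> z)) *\<^sub>R z) = sqrt ((x \<bullet> z)\<^sup>2 + (r * norm x)\<^sup>2)"
      by (metis norm_ge_zero real_sqrt_abs abs_of_nonneg)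
    then show ?thesis by (simp add: T_def)
  qed
  have "inj T"
  proof (subst linear_injective_0[OF lin], intro allI impI)
    fix x assume "T x = 0"
    then have "sqrt ((x \<bullet> z)\<^sup>2 + (r * norm x)\<^sup>2) = 0" using nT[of x] by simp
    then show "x = 0" using r by (simp add: sum_power2_eq_zero_iff)
  qed
  then have "bij T" using linear_injective_imp_surjective[OF lin] by (simp add: bij_def)
  moreover have "ln (norm (T x)) = C + smooth_ln r (x \<bullet> z)" if "norm x = 1" for x
  proof -
    have "0 < (x \<bullet> z)\<^sup>2 + r\<^sup>2" using r by (simp add: add_nonneg_pos)
    then show ?thesis using that r by (simp add: nT smooth_ln_def ln_mult)
  qed
  ultimately show ?thesis using lin that by blast
qed

text \<open>Simple functions approximate the identity in \<open>L\<^sup>1(\<mu>)\<close> and the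
  kernel is \<open>1 / r\<close>-Lipschitz, so the image of \<open>\<mu>\<close> under such a
  function has nearly the same potential, uniformly on the sphere. Its atoms may leave the sphere
  but stay in the ball of radius \<open>2\<close>.\<close>

lemma approximate_smooth_potential:
  fixes \<mu> :: "(real ^ 'n) measure"
  assumes prob: "prob_space \<mu>" and sets: "sets \<mu> = sets (restrict_space borel (sphere 0 1))"
    and r: "0 < r" and e: "0 < e"
  obtains I :: "(real ^ 'n) set" and w where "finite I" "\<And>z. z \<in> I \<Longrightarrow> 0 < w z" "sum w I = 1"
    "\<And>x. norm x = 1 \<Longrightarrow> \<bar>(\<Sum>z\<in>I. w z * smooth_ln r (x \<bullet> z)) - (\<integral>\<xi>. smooth_ln r (x \<bullet> \<xi>) \<partial>\<mu>)\<bar> \<le> e"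
proof -
  interpret prob_space \<mu> by (rule prob)
  have sp: "space \<mu> = sphere 0 1" using sets_eq_imp_space_eq[OF sets] by (simp add: space_restrict_space)
  have id: "(\<lambda>\<xi>. \<xi>) \<in> borel_measurable \<mu>"
    by (subst measurable_cong_sets[OF sets refl]) (rule measurable_restrict_space1, simp)
  obtain F where F: "\<And>i. simple_function \<mu> (F i)" "\<And>\<xi>. \<xi> \<in> space \<mu> \<Longrightarrow> (\<lambda>i. F i \<xi>) \<longlonglongrightarrow> \<xi>"
      "\<And>i \<xi>. \<xi> \<in> space \<mu> \<Longrightarrow> dist (F i \<xi>) 0 \<le> 2 * dist \<xi> 0"
    using borel_measurable_implies_sequence_metric[OF id, of 0] by blast
  note Fm = borel_measurable_simple_function[OF F(1)]
  note [measurable] = id Fm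
  have lim: "(\<lambda>i. \<integral>\<xi>. norm (F i \<xi> - \<xi>) \<partial>\<mu>) \<longlonglongrightarrow> (\<integral>\<xi>. 0 \<partial>\<mu>)"
  proof (rule integral_dominated_convergence[where w="\<lambda>_. 3"])
    show "AE \<xi> in \<mu>. (\<lambda>i. norm (F i \<xi> - \<xi>)) \<longlonglongrightarrow> 0"
    proof (rule AE_I2)
      fix \<xi> assume "\<xi> \<in> space \<mu>"
      from tendsto_norm_zero[OF LIM_zero[OF F(2)[OF this]]] show "(\<lambda>i. norm (F i \<xi> - \<xi>)) \<longlonglongrightarrow> 0" .
    qed
    show "AE \<xi> in \<mu>. norm (norm (F i \<xi> - \<xi>)) \<le> 3" for i
    proof (rule AE_I2)
      fix \<xi> assume "\<xi> \<in> space \<mu>"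
      then have "norm (F i \<xi>) \<le> 2" "norm \<xi> = 1" using F(3)[of \<xi> i] by (auto simp: sp)
      then show "norm (norm (F i \<xi> - \<xi>)) \<le> 3" using norm_triangle_ineq4[of "F i \<xi>" \<xi>] by simp
    qed
  qed auto
  \<comment> \<open>The factor \<open>r\<close> offsets the Lipschitz constant
    \<open>1 / r\<close>.\<close>
  have "\<forall>\<^sub>F i in sequentially. (\<integral>\<xi>. norm (F i \<xi> - \<xi>) \<partial>\<mu>) < e * r"
    using order_tendstoD(2)[OF lim, of "e * r"] e r by simp
  then obtain i where i: "(\<integral>\<xi>. norm (F i \<xi> - \<xi>) \<partial>\<mu>) < e * r"
    by (auto simp: eventually_sequentially)
  have bound: "norm (F i \<xi>) \<le> 2" "norm \<xi> = 1" if "\<xi> \<in> space \<mu>" for \<xi>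
    using F(3)[of \<xi> i] that by (auto simp: sp)
  define w where "w z = measure \<mu> (F i -` {z} \<inter> space \<mu>)" for z
  define J where "J = F i ` space \<mu>"
  \<comment> \<open>Values taken only on a null set are discarded, since the exponents of an
    ellipsoid product must be positive.\<close>
  define I where "I = {z \<in> J. 0 < w z}"
  have J: "finite J" using simple_functionD(1)[OF F(1)] by (simp add: J_def)
  have A: "F i -` {z} \<inter> space \<mu> \<in> sets \<mu>" for z using simple_functionD(2)[OF F(1)] .
  have w0: "w z = 0" if "z \<in> J - I" for z using that measure_nonneg[of \<mu>] by (simp add: I_def w_def less_le)
  have simple: "(\<integral>\<xi>. h (F i \<xi>) \<partial>\<mu>) = (\<Sum>z\<in>I. w z * h z)" for h :: "real ^ 'n \<Rightarrow> real"
  proof -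
    have "(\<integral>\<xi>. h (F i \<xi>) \<partial>\<mu>) = (\<integral>\<xi>. (\<Sum>z\<in>J. indicator (F i -` {z} \<inter> space \<mu>) \<xi> * h z) \<partial>\<mu>)"
    proof (rule Bochner_Integration.integral_cong[OF refl])
      fix \<xi> assume \<xi>: "\<xi> \<in> space \<mu>"
      have "(\<Sum>z\<in>J. indicator (F i -` {z} \<inter> space \<mu>) \<xi> * h z) = (\<Sum>z\<in>J. if z = F i \<xi> then h z else 0)"
        using \<xi> by (intro sum.cong) (auto simp: indicator_def)
      then show "h (F i \<xi>) = (\<Sum>z\<in>J. indicator (F i -` {z} \<inter> space \<mu>) \<xi> * h z)"
        using J \<xi> by (simp add: J_def)
    qed
    also have "\<dots> = (\<Sum>z\<in>J. w z * h z)"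
      using A by (subst Bochner_Integration.integral_sum) (auto simp: w_def less_top[symmetric])
    also have "\<dots> = (\<Sum>z\<in>I. w z * h z)"
      using J w0 by (intro sum.mono_neutral_right) (auto simp: I_def)
    finally show ?thesis .
  qed
  have "sum w I = 1" using simple[of "\<lambda>_. 1"] by (simp add: prob_space)
  moreover have "\<bar>(\<Sum>z\<in>I. w z * smooth_ln r (x \<bullet> z)) - (\<integral>\<xi>. smooth_ln r (x \<bullet> \<xi>) \<partial>\<mu>)\<bar> \<le> e" if x: "norm x = 1" for x
  proof -
    have "\<bar>x \<bullet> y\<bar> \<le> 2" if "norm y \<le> 2" for y
      using Cauchy_Schwarz_ineq2[of x y] x that by simp
    then have b: "\<bar>smooth_ln r (x \<bullet> y)\<bar> \<le> \<bar>ln r\<bar> + \<bar>smooth_ln r 2\<bar>" if "norm y \<le> 2" for y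
      using abs_smooth_ln_le[OF r] that by blast
    have int: "integrable \<mu> (\<lambda>\<xi>. smooth_ln r (x \<bullet> F i \<xi>))" "integrable \<mu> (\<lambda>\<xi>. smooth_ln r (x \<bullet> \<xi>))"
      using bound by (auto intro!: integrable_const_bound[of _ "\<bar>ln r\<bar> + \<bar>smooth_ln r 2\<bar>"] AE_I2 b)
    have intn: "integrable \<mu> (\<lambda>\<xi>. norm (F i \<xi> - \<xi>))"
    proof (rule integrable_const_bound[of _ 3])
      show "AE \<xi> in \<mu>. norm (norm (F i \<xi> - \<xi>)) \<le> 3"
      proof (rule AE_I2)
        fix \<xi> assume "\<xi> \<in> space \<mu>"
        from bound[OF this] show "norm (norm (F i \<xi> - \<xi>)) \<le> 3" using norm_triangle_ineq4[of "F i \<xi>" \<xi>] by simp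
      qed
    qed measurable
    have "\<bar>(\<Sum>z\<in>I. w z * smooth_ln r (x \<bullet> z)) - (\<integral>\<xi>. smooth_ln r (x \<bullet> \<xi>) \<partial>\<mu>)\<bar> =
        norm (\<integral>\<xi>. smooth_ln r (x \<bullet> F i \<xi>) - smooth_ln r (x \<bullet> \<xi>) \<partial>\<mu>)"
      using int simple[of "\<lambda>z. smooth_ln r (x \<bullet> z)"] by simp
    also have "\<dots> \<le> (\<integral>\<xi>. norm (smooth_ln r (x \<bullet> F i \<xi>) - smooth_ln r (x \<bullet> \<xi>)) \<partial>\<mu>)"
      by (rule integral_norm_bound)
    also have "\<dots> \<le> (\<integral>\<xi>. norm (F i \<xi> - \<xi>) / r \<partial>\<mu>)"
    proof (rule integral_mono)
      fix \<xi>
      have "\<bar>x \<bullet> F i \<xi> - x \<bullet> \<xi>\<bar> \<le> norm (F i \<xi> - \<xi>)"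
        using Cauchy_Schwarz_ineq2[of x "F i \<xi> - \<xi>"] x by (simp add: inner_diff_right)
      then have "\<bar>x \<bullet> F i \<xi> - x \<bullet> \<xi>\<bar> / r \<le> norm (F i \<xi> - \<xi>) / r"
        using r by (intro divide_right_mono) auto
      then show "norm (smooth_ln r (x \<bullet> F i \<xi>) - smooth_ln r (x \<bullet> \<xi>)) \<le> norm (F i \<xi> - \<xi>) / r"
        unfolding real_norm_def by (rule order_trans[OF smooth_ln_lipschitz[OF r]])
    qed (use int intn in auto)
    also have "\<dots> \<le> e" using i r by (simp add: field_simps)
    finally show ?thesis .
  qed
  moreover have "finite I" "\<And>z. z \<in> I \<Longrightarrow> 0 < w z" using J by (auto simp: I_def)
  ultimately show ?thesis by (intro that)
qed

text \<open>The mass is one by homogeneity: replacing \<open>x\<close> by \<open>2 x\<close> adds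
  \<open>ln 2\<close> to the logarithm of the norm and \<open>ln 2\<close> times the mass to the
  integral.\<close>

lemma embeds_in_L0E:
  fixes K :: "(real ^ 'n) set"
  assumes K: "star_body K" and "embeds_in_L0 K"
  obtains \<mu> :: "(real ^ 'n) measure" and C where "prob_space \<mu>" "sets \<mu> = sets (restrict_space borel (sphere 0 1))"
    "\<And>x. x \<noteq> 0 \<Longrightarrow> AE \<xi> in \<mu>. x \<bullet> \<xi> \<noteq> 0" "\<And>x. x \<noteq> 0 \<Longrightarrow> integrable \<mu> (\<lambda>\<xi>. ln \<bar>x \<bullet> \<xi>\<bar>)"
    "\<And>x. x \<noteq> 0 \<Longrightarrow> (\<integral>\<xi>. ln \<bar>x \<bullet> \<xi>\<bar> \<partial>\<mu>) = ln (minkowski K x) - C"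
proof -
  note hom = pos_homogeneous_minkowski[OF K]
  obtain \<mu> :: "(real ^ 'n) measure" and C where fin: "finite_measure \<mu>"
    and sets: "sets \<mu> = sets (restrict_space borel (sphere 0 1))"
    and eq: "\<And>x. ext_ln (minkowski K x) = ext_integral \<mu> (\<lambda>\<xi>. ext_ln \<bar>x \<bullet> \<xi>\<bar>) + ereal C"
    using assms(2) unfolding embeds_in_L0_def by blast
  interpret finite_measure \<mu> by (rule fin)
  have main: "(AE \<xi> in \<mu>. x \<bullet> \<xi> \<noteq> 0) \<and> integrable \<mu> (\<lambda>\<xi>. ln \<bar>x \<bullet> \<xi>\<bar>) \<and>
      (\<integral>\<xi>. ln \<bar>x \<bullet> \<xi>\<bar> \<partial>\<mu>) = ln (minkowski K x) - C" if x: "x \<noteq> 0" for x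
  proof -
    have h: "(\<lambda>\<xi>. \<bar>x \<bullet> \<xi>\<bar>) \<in> borel_measurable \<mu>"
      by (subst measurable_cong_sets[OF sets refl], rule measurable_restrict_space1) measurable
    have "ereal (ln (minkowski K x)) = ext_integral \<mu> (\<lambda>\<xi>. ext_ln \<bar>x \<bullet> \<xi>\<bar>) + ereal C"
      using eq[of x] pos_homogeneous_pos[OF hom x] by (simp add: ext_ln_def)
    then have "ext_integral \<mu> (\<lambda>\<xi>. ext_ln \<bar>x \<bullet> \<xi>\<bar>) = ereal (ln (minkowski K x) - C)"
      by (cases "ext_integral \<mu> (\<lambda>\<xi>. ext_ln \<bar>x \<bullet> \<xi>\<bar>)") auto
    then show ?thesis using ext_integral_ext_ln[OF h] by simp
  qed
  have "measure \<mu> (space \<mu>) = 1"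
  proof -
    obtain i :: 'n where True by simp
    let ?x = "axis i 1 :: real ^ 'n"
    have x: "?x \<noteq> 0" "2 *\<^sub>R ?x \<noteq> 0" by simp_all
    have "(\<integral>\<xi>. ln \<bar>(2 *\<^sub>R ?x) \<bullet> \<xi>\<bar> \<partial>\<mu>) = (\<integral>\<xi>. ln 2 + ln \<bar>?x \<bullet> \<xi>\<bar> \<partial>\<mu>)"
    proof (rule integral_cong_AE)
      show "AE \<xi> in \<mu>. ln \<bar>(2 *\<^sub>R ?x) \<bullet> \<xi>\<bar> = ln 2 + ln \<bar>?x \<bullet> \<xi>\<bar>"
        using conjunct1[OF main[OF x(1)]] by eventually_elim (simp add: abs_mult ln_mult)
    qed (use main[OF x(1)] main[OF x(2)] in \<open>auto intro: borel_measurable_integrable\<close>)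
    also have "\<dots> = ln 2 * measure \<mu> (space \<mu>) + (\<integral>\<xi>. ln \<bar>?x \<bullet> \<xi>\<bar> \<partial>\<mu>)"
      using main[OF x(1)] by (subst Bochner_Integration.integral_add) (auto simp: mult.commute)
    finally have "ln (minkowski K (2 *\<^sub>R ?x)) - C = ln 2 * measure \<mu> (space \<mu>) + (ln (minkowski K ?x) - C)"
      using main[OF x(1)] main[OF x(2)] by simp
    moreover have "ln (minkowski K (2 *\<^sub>R ?x)) = ln 2 + ln (minkowski K ?x)"
      using pos_homogeneous_scale[OF hom, of 2 ?x] pos_homogeneous_pos[OF hom x(1)] by (simp add: ln_mult)
    ultimately have "ln 2 * measure \<mu> (space \<mu>) = ln (2::real) * 1" by simp
    then show ?thesis by (subst (asm) mult_cancel_left) simp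
  qed
  then have "prob_space \<mu>" by (intro prob_spaceI) (simp add: emeasure_eq_measure)
  then show ?thesis using that[of \<mu> C] sets main by blast
qed

text \<open>The radial difference is \<open>(exp t - 1) / minkowski K u\<close>, where
  \<open>t\<close> is the difference of the logarithms.\<close>

lemma radial_dist_le:
  fixes K L :: "(real ^ 'n) set"
  assumes L: "star_body L" and K: "star_body K" and m: "0 < m" "\<And>u. norm u = 1 \<Longrightarrow> m \<le> minkowski K u"
    and d: "\<And>u. norm u = 1 \<Longrightarrow> \<bar>ln (minkowski L u) - ln (minkowski K u)\<bar> \<le> d"
  shows "radial_dist L K \<le> (exp d - 1) / m"
  unfolding radial_dist_def
proof (rule cSUP_least)
  show "sphere (0 :: real ^ 'n) 1 \<noteq> {}" by simp
  fix u :: "real ^ 'n" assume "u \<in> sphere 0 1"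
  then have u: "norm u = 1" "u \<noteq> 0" by auto
  note gL = pos_homogeneous_pos[OF pos_homogeneous_minkowski[OF L] u(2)]
    and gK = pos_homogeneous_pos[OF pos_homogeneous_minkowski[OF K] u(2)]
  define t where "t = ln (minkowski K u) - ln (minkowski L u)"
  have t: "\<bar>t\<bar> \<le> d" using d[OF u(1)] by (simp add: t_def abs_minus_commute)
  have "exp t = minkowski K u / minkowski L u" using gL gK by (simp add: t_def exp_diff)
  then have "radial L u - radial K u = (exp t - 1) / minkowski K u"
    using gL gK by (simp add: radial_def field_simps)
  then have "\<bar>radial L u - radial K u\<bar> = \<bar>exp t - 1\<bar> / minkowski K u"
    using gK by (simp add: abs_divide)
  also have "\<dots> \<le> (exp d - 1) / m"
  proof (rule frac_le)
    have "exp t - 1 \<le> exp d - 1" using t by simp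
    \<comment> \<open>For negative \<open>t\<close>, the inequality
      \<open>exp t + exp (- t) \<ge> 2\<close> reduces the claim to \<open>- t\<close>.\<close>
    moreover have "1 - exp t \<le> exp d - 1"
    proof -
      have "2 \<le> exp t + exp (- t)" using exp_ge_add_one_self[of t] exp_ge_add_one_self[of "- t"] by linarith
      moreover have "exp (- t) \<le> exp d" using t by simp
      ultimately show ?thesis by linarith
    qed
    ultimately show "\<bar>exp t - 1\<bar> \<le> exp d - 1" by linarith
    then show "0 \<le> exp d - 1" by linarith
  qed (use m u in auto)
  finally show "\<bar>radial L u - radial K u\<bar> \<le> (exp d - 1) / m" .
qed

text \<open>One half of \<open>e\<close> pays for smoothing, the other for discretising. The radius
  has to be fixed first, because the quality of the discretisation depends on it; uniformity in the
  first step is what allows a single radius.\<close>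

theorem ellipsoid_product_approximation:
  fixes K :: "(real ^ 'n) set"
  assumes K: "star_body K" and emb: "embeds_in_L0 K" and e: "0 < e"
  shows "\<exists>L. star_body L \<and> ellipsoid_product (minkowski L) \<and>
    (\<forall>u. norm u = 1 \<longrightarrow> \<bar>ln (minkowski L u) - ln (minkowski K u)\<bar> \<le> e)"
proof -
  note hom = pos_homogeneous_minkowski[OF K]
  obtain \<mu> :: "(real ^ 'n) measure" and C where prob: "prob_space \<mu>"
    and sets: "sets \<mu> = sets (restrict_space borel (sphere 0 1))"
    and nz: "\<And>x. x \<noteq> 0 \<Longrightarrow> AE \<xi> in \<mu>. x \<bullet> \<xi> \<noteq> 0" and int: "\<And>x. x \<noteq> 0 \<Longrightarrow> integrable \<mu> (\<lambda>\<xi>. ln \<bar>x \<bullet> \<xi>\<bar>)"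
    and eq: "\<And>x. x \<noteq> 0 \<Longrightarrow> (\<integral>\<xi>. ln \<bar>x \<bullet> \<xi>\<bar> \<partial>\<mu>) = ln (minkowski K x) - C"
    by (rule embeds_in_L0E[OF K emb]) (rule that)
  interpret prob_space \<mu> by (rule prob)
  have sp: "space \<mu> = sphere 0 1" using sets_eq_imp_space_eq[OF sets] by (simp add: space_restrict_space)
  have id [measurable]: "(\<lambda>\<xi>. \<xi>) \<in> borel_measurable \<mu>"
    by (subst measurable_cong_sets[OF sets refl]) (rule measurable_restrict_space1, simp)
  define r where "r j = inverse (real (Suc j))" for j
  have r: "\<And>j. 0 < r j" "\<And>j. r j \<le> 1" "decseq r" "r \<longlonglongrightarrow> 0"
    using LIMSEQ_inverse_real_of_nat by (auto simp: decseq_def field_simps r_def[abs_def])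
  define f where "f j x = (\<integral>\<xi>. smooth_ln (r j) (x \<bullet> \<xi>) \<partial>\<mu>)" for j and x :: "real ^ 'n"
  have intf: "integrable \<mu> (\<lambda>\<xi>. smooth_ln (r j) (x \<bullet> \<xi>))" for j x
    by (rule integrable_const_bound[of _ "\<bar>ln (r j)\<bar> + \<bar>smooth_ln (r j) (norm x)\<bar>"])
      (auto intro!: AE_I2 abs_smooth_ln_inner_le r(1) simp: sp)
  have lip: "\<bar>f j x - f j y\<bar> \<le> norm (x - y) / r j" for j x y
  proof -
    have "\<bar>f j x - f j y\<bar> = norm (\<integral>\<xi>. smooth_ln (r j) (x \<bullet> \<xi>) - smooth_ln (r j) (y \<bullet> \<xi>) \<partial>\<mu>)"
      unfolding f_def using intf by simp
    also have "\<dots> \<le> (\<integral>\<xi>. norm (smooth_ln (r j) (x \<bullet> \<xi>) - smooth_ln (r j) (y \<bullet> \<xi>)) \<partial>\<mu>)"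
      by (rule integral_norm_bound)
    also have "\<dots> \<le> (\<integral>\<xi>. norm (x - y) / r j \<partial>\<mu>)"
    proof (rule integral_mono)
      fix \<xi> assume "\<xi> \<in> space \<mu>"
      then have "\<bar>x \<bullet> \<xi> - y \<bullet> \<xi>\<bar> \<le> norm (x - y)"
        using Cauchy_Schwarz_ineq2[of "x - y" \<xi>] by (simp add: sp inner_diff_left)
      then have "\<bar>x \<bullet> \<xi> - y \<bullet> \<xi>\<bar> / r j \<le> norm (x - y) / r j"
        using r(1)[of j] by (intro divide_right_mono) auto
      then show "norm (smooth_ln (r j) (x \<bullet> \<xi>) - smooth_ln (r j) (y \<bullet> \<xi>)) \<le> norm (x - y) / r j"
        unfolding real_norm_def by (rule order_trans[OF smooth_ln_lipschitz[OF r(1)]])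
    qed (use intf in auto)
    finally show ?thesis by (simp add: prob_space)
  qed
  have cont: "continuous_on (sphere 0 1) (f j)" for j
  proof (rule continuous_onI)
    fix x :: "real ^ 'n" and d :: real assume "0 < d"
    show "\<exists>\<delta>>0. \<forall>y\<in>sphere 0 1. dist y x < \<delta> \<longrightarrow> dist (f j y) (f j x) \<le> d"
    proof (intro exI[of _ "d * r j"] conjI ballI impI)
      show "0 < d * r j" using \<open>0 < d\<close> r(1) by simp
      fix y assume "dist y x < d * r j"
      then have "norm (y - x) / r j \<le> d" using r(1)[of j] by (simp add: dist_norm field_simps)
      then show "dist (f j y) (f j x) \<le> d" using lip[of j y x] by (simp add: dist_norm)
    qed
  qed
  define l where "l x = ln (minkowski K x) - C" for x
  have nzs: "x \<noteq> 0" if "x \<in> sphere 0 1" for x :: "real ^ 'n" using that by auto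
  have contl: "continuous_on (sphere 0 1) l" unfolding l_def
    using pos_homogeneous_pos[OF hom nzs]
    by (intro continuous_intros pos_homogeneous_continuous[OF hom]) (auto simp: less_le)
  have dec: "decseq (\<lambda>j. f j x)" for x
    unfolding f_def decseq_def using r(1,3)
    by (auto intro!: integral_mono intf smooth_ln_mono simp: decseq_def)
  have lim: "(\<lambda>j. f j x) \<longlonglongrightarrow> l x" if x: "x \<in> sphere 0 1" for x
  proof -
    have "(\<lambda>j. f j x) \<longlonglongrightarrow> (\<integral>\<xi>. ln \<bar>x \<bullet> \<xi>\<bar> \<partial>\<mu>)"
      unfolding f_def
    \<comment> \<open>The kernel is squeezed between \<open>ln |x \<bullet> \<xi>|\<close>,
      integrable by the embedding, and \<open>smooth_ln 1\<close>, bounded on the sphere.\<close>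
    proof (rule integral_dominated_convergence[where w="\<lambda>\<xi>. \<bar>ln \<bar>x \<bullet> \<xi>\<bar>\<bar> + \<bar>smooth_ln 1 (norm x)\<bar>"])
      show "integrable \<mu> (\<lambda>\<xi>. \<bar>ln \<bar>x \<bullet> \<xi>\<bar>\<bar> + \<bar>smooth_ln 1 (norm x)\<bar>)" using int[OF nzs[OF x]] by simp
      show "AE \<xi> in \<mu>. (\<lambda>j. smooth_ln (r j) (x \<bullet> \<xi>)) \<longlonglongrightarrow> ln \<bar>x \<bullet> \<xi>\<bar>"
        using nz[OF nzs[OF x]] by eventually_elim (intro smooth_ln_tendsto r(4))
      show "AE \<xi> in \<mu>. norm (smooth_ln (r j) (x \<bullet> \<xi>)) \<le> \<bar>ln \<bar>x \<bullet> \<xi>\<bar>\<bar> + \<bar>smooth_ln 1 (norm x)\<bar>" for j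
        using nz[OF nzs[OF x]] AE_space
      proof eventually_elim
        case (elim \<xi>)
        have "ln \<bar>x \<bullet> \<xi>\<bar> \<le> smooth_ln (r j) (x \<bullet> \<xi>)" by (rule ln_le_smooth_ln[OF elim(1)])
        moreover have "smooth_ln (r j) (x \<bullet> \<xi>) \<le> smooth_ln 1 (x \<bullet> \<xi>)"
          using r by (intro smooth_ln_mono) auto
        moreover have "\<bar>smooth_ln 1 (x \<bullet> \<xi>)\<bar> \<le> \<bar>smooth_ln 1 (norm x)\<bar>"
          using abs_smooth_ln_inner_le[of 1 \<xi> x] elim by (simp add: sp)
        ultimately show ?case unfolding real_norm_def by linarith
      qed
    qed (use int[OF nzs[OF x]] in auto)
    then show ?thesis by (simp add: l_def eq[OF nzs[OF x]])
  qed
  have "\<exists>j. \<forall>x\<in>sphere 0 1. f j x < l x + e / 2"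
    by (rule dini_decreasing[OF compact_sphere cont contl dec lim]) (use e in simp_all)
  then obtain j where j: "\<And>x. x \<in> sphere 0 1 \<Longrightarrow> f j x < l x + e / 2" by blast
  \<comment> \<open>Together with \<open>j\<close> this makes the one-sided estimate from Dini's
    theorem two-sided.\<close>
  have ge: "l x \<le> f j x" if "x \<in> sphere 0 1" for x
    using decseq_ge[OF dec lim[OF that]] .
  have "0 < e / 2" using e by simp
  then obtain I :: "(real ^ 'n) set" and w where I: "finite I" and w: "\<And>z. z \<in> I \<Longrightarrow> 0 < w z" "sum w I = 1"
    and app: "\<And>x. norm x = 1 \<Longrightarrow> \<bar>(\<Sum>z\<in>I. w z * smooth_ln (r j) (x \<bullet> z)) - f j x\<bar> \<le> e / 2"
    by (rule approximate_smooth_potential[OF prob sets r(1)[of j]]) (rule that[unfolded f_def])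
  \<comment> \<open>Every factor carries the full constant \<open>C\<close>; since the weights sum
    to one, the logarithm of the product receives it exactly once.\<close>
  define P where "P z T \<longleftrightarrow> linear T \<and> bij T \<and> (\<forall>x. norm x = 1 \<longrightarrow> ln (norm (T x)) = C + smooth_ln (r j) (x \<bullet> z))"
    for z and T :: "real ^ 'n \<Rightarrow> real ^ 'n"
  have "\<exists>T. P z T" for z by (rule norm_linear_smooth_ln[OF r(1)[of j], where z = z and C = C]) (auto simp: P_def)
  then obtain T where "\<And>z. P z (T z)" by metis
  then have T: "\<And>z. linear (T z)" "\<And>z. bij (T z)"
    and lnT: "\<And>z x. norm x = 1 \<Longrightarrow> ln (norm (T z x)) = C + smooth_ln (r j) (x \<bullet> z)"
    by (auto simp: P_def)
  define g where "g x = (\<Prod>z\<in>I. norm (T z x) powr w z)" for x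
  have Tw: "linear (T z) \<and> bij (T z) \<and> 0 < w z" if "z \<in> I" for z using T w that by blast
  note G = ellipsoid_productI[OF I Tw w(2), folded g_def]
  have Gm: "minkowski {y. g y \<le> 1} = g" by (rule minkowski_sublevel[OF G(2)])
  have "\<bar>ln (g u) - ln (minkowski K u)\<bar> \<le> e" if u: "norm u = 1" for u
  proof -
    have u0: "u \<noteq> 0" "u \<in> sphere 0 1" using u by auto
    have "ln (g u) = (\<Sum>z\<in>I. w z * (C + smooth_ln (r j) (u \<bullet> z)))"
      using G(5)[OF _ u0(1)] by (simp add: lnT[OF u])
    also have "\<dots> = C + (\<Sum>z\<in>I. w z * smooth_ln (r j) (u \<bullet> z))"
      using w(2) by (simp add: distrib_left sum.distrib sum_distrib_right[symmetric])
    finally show ?thesis using app[OF u] j[OF u0(2)] ge[OF u0(2)] unfolding l_def by linarith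
  qed
  moreover have "star_body {y. g y \<le> 1}" by (rule star_body_sublevel[OF G(2-4)])
  ultimately show ?thesis using Gm G(1) by (intro exI[of _ "{y. g y \<le> 1}"]) simp
qed

theorem theorem5p4:
  fixes K :: "(real ^ 'n) set"
  assumes "star_body K"
  shows "embeds_in_L0 K \<longleftrightarrow>
    (\<exists>L :: nat \<Rightarrow> (real ^ 'n) set.
       (\<forall>k. star_body (L k) \<and> ellipsoid_product (minkowski (L k))) \<and>
       (\<lambda>k. radial_dist (L k) K) \<longlonglongrightarrow> 0)"
proof
  assume emb: "embeds_in_L0 K"
  obtain m M where m: "0 < m" "\<And>u. norm u = 1 \<Longrightarrow> m \<le> minkowski K u \<and> minkowski K u \<le> M"
    using pos_homogeneous_bounds[OF pos_homogeneous_minkowski[OF assms]] by blast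
  define d where "d k = inverse (real (Suc k))" for k
  have "\<exists>L. star_body L \<and> ellipsoid_product (minkowski L) \<and>
      (\<forall>u. norm u = 1 \<longrightarrow> \<bar>ln (minkowski L u) - ln (minkowski K u)\<bar> \<le> d k)" for k
    by (rule ellipsoid_product_approximation[OF assms emb]) (simp add: d_def)
  then obtain L where L: "\<And>k. star_body (L k)" "\<And>k. ellipsoid_product (minkowski (L k))"
    and le: "\<And>k u. norm u = 1 \<Longrightarrow> \<bar>ln (minkowski (L k) u) - ln (minkowski K u)\<bar> \<le> d k"
    by metis
  have "(\<lambda>k. (exp (d k) - 1) / m) \<longlonglongrightarrow> (exp 0 - 1) / m"
    unfolding d_def using m(1) by (intro tendsto_intros LIMSEQ_inverse_real_of_nat) simp
  then have lim: "(\<lambda>k. (exp (d k) - 1) / m) \<longlonglongrightarrow> 0" by simp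
  have ub: "radial_dist (L k) K \<le> (exp (d k) - 1) / m" for k
    using m(2) by (intro radial_dist_le[OF L(1) assms m(1)] le) blast+
  \<comment> \<open>\<open>direction 0\<close> serves as some unit vector at which the supremum is
    at least an absolute value.\<close>
  have lb: "0 \<le> radial_dist (L k) K" for k
    using radial_diff_le_radial_dist[OF L(1) assms norm_direction[of 0]] by (rule order_trans[OF abs_ge_zero])
  have "(\<lambda>k. radial_dist (L k) K) \<longlonglongrightarrow> 0"
    by (rule tendsto_sandwich[OF always_eventually[OF allI[OF lb]] always_eventually[OF allI[OF ub]]
        tendsto_const lim])
  with L show "\<exists>L. (\<forall>k. star_body (L k) \<and> ellipsoid_product (minkowski (L k))) \<and>
      (\<lambda>k. radial_dist (L k) K) \<longlonglongrightarrow> 0"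
    by blast
next
  assume "\<exists>L. (\<forall>k. star_body (L k) \<and> ellipsoid_product (minkowski (L k))) \<and>
      (\<lambda>k. radial_dist (L k) K) \<longlonglongrightarrow> 0"
  then show "embeds_in_L0 K" using embeds_in_L0_limit[OF assms] by blast
qed

end
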